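(* Let $\{\Phi_n\}_{n=1}^\infty$, $\Phi_n=\{\phi_{n,j}\}_{j=1}^{N_n}$, be a self-similar MIFS on a compact set $X\subset\mathbb{R}^d$, where $\phi_{n,j}(x)=r_{n,j}O_{n,j}(x+\alpha_{n,j})$ with $r_{n,j}\in(0,1)$, $O_{n,j}$ orthogonal matrices and $\alpha_{n,j}\in\mathbb{R}^d$. Assume that the MIFS satisfies the Moran-type weak separation condition (MWSC). (i) If $r_0:=\inf\{r_{n,j}:1\le j\le N_n,\ n\ge1\}>0$, then for all $n\ge1$ $$\underline{\dim}_{\rm B}K_n=\liminf_{b\to0^+}\frac{\ln\#\mathcal{A}_b}{-\ln b}\le\limsup_{b\to0^+}\frac{\ln\#\mathcal{A}_b}{-\ln b}=\overline{\dim}_{\rm B}K_n=\dim_{\rm P}K_n.$$ (ii) If $r_{n,j}=r_n$ for all $n\ge1$ and $1\le j\le N_n$, and $$\lim_{n\to+\infty}\frac{\ln r_n}{\ln(r_1r_2\cdots r_{n-1})}=0,$$ then for all $n\ge1$ $$\underline{\dim}_{\rm B}K_n=\liminf_{b\to0^+}\frac{\ln\#\mathcal{A}_b}{-\ln b}=\liminf_{m\to+\infty}\frac{\ln\#\mathcal{A}_{r_1r_2\cdots r_m}}{-\ln(r_1r_2\cdots r_m)}$$ and $$\overline{\dim}_{\rm B}K_n=\dim_{\rm P}K_n=\limsup_{b\to0^+}\frac{\ln\#\mathcal{A}_b}{-\ln b}=\limsup_{m\to+\infty}\frac{\ln\#\mathcal{A}_{r_1r_2\cdots r_m}}{-\ln(r_1r_2\cdots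 r_m)}.$$
   Context: Self-similar MIFS. $X\subset\mathbb{R}^d$ is a nonempty compact set; for each $n\ge1$, $\Phi_n=\{\phi_{n,j}\}_{j=1}^{N_n}$ with $2\le N_n<+\infty$ consists of contracting similarities $\phi_{n,j}(x)=r_{n,j}O_{n,j}(x+\alpha_{n,j})$ with $\phi_{n,j}(X)\subseteq X$; and there are constants $0<c_{1,n}\le c_{2,n}<1$ with $c_{1,n}\le r_{n,j}\le c_{2,n}$ for all $1\le j\le N_n$ and $\lim_{n\to\infty}\prod_{j=1}^n c_{2,j}=0$. The metric is the Euclidean one. Attractors. For each $n\ge1$, $K_n=\{\lim_{k\to\infty}\phi_{n,j_n}\circ\cdots\circ\phi_{n+k,j_{n+k}}(a): 1\le j_{n+k}\le N_{n+k},\ k\ge0\}$, a compact set independent of $a\in X$; $\{K_n\}$ is the unique sequence of nonempty compact subsets of $X$ with $K_n=\bigcup_{j=1}^{N_n}\phi_{n,j}(K_{n+1})$ for all $n\ge 1$. Words. $\Sigma_1^k=\prod_{i=1}^k\{1,\dots,N_i\}$ and $\Sigma_1^*=\bigcup_{k\ge0}\Sigma_1^k$, where $\Sigma_1^0$ contains only the empty word. For $J=j_1\cdots j_k$, $|J|=k$ is its length, $\phi_{1,J}=\phi_{1,j_1}\circ\phi_{2,j_2}\circ\cdots\circ\phi_{k,j_k}$ (identity for the empty word), and $R_J=r_{1,j_1}r_{2,j_2}\cdots r_{k,j_k}$ is its contraction ratio ($R=1$ for the empty word). For $b\in(0,1)$, $$\mathcal{I}_b=\{j_1\cdots j_n\in\Sigma_1^*:\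 R_{j_1\cdots j_n}\le b<R_{j_1\cdots j_{n-1}}\},\qquad \mathcal{A}_b=\{\phi_{1,J}:J\in\mathcal{I}_b\},$$ where $\mathcal{A}_b$ is a set of maps (equal maps are counted once), and $\#$ denotes cardinality. MWSC. There is a sequence of (Lebesgue measurable) subsets $U_n\subseteq X$ with $\inf_{n\ge1}\mathcal{L}^d(U_n)>0$ ($\mathcal{L}^d$ is $d$-dimensional Lebesgue measure) and $$\sup_{0<b<1}\max_{I\in\mathcal{I}_b}\#\{\phi_{1,J}:\ J\in\mathcal{I}_b,\ \phi_{1,J}(U_{|J|+1})\cap\phi_{1,I}(U_{|I|+1})\ne\emptyset\}<+\infty.$$ $\underline{\dim}_{\rm B}$, $\overline{\dim}_{\rm B}$, $\dim_{\rm P}$ denote lower box, upper box and packing dimension. *)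

theory Defs
  imports "HOL-Analysis.Analysis"
begin

(* Levels n and symbols j are 1-based.  The values of N, \<phi>, r, Om, \<alpha>
   at level 0 or at symbols outside {1..N n} are unconstrained and irrelevant. *)

definition self_similar_MIFS ::
  "(real ^ 'd) set \<Rightarrow> (nat \<Rightarrow> nat) \<Rightarrow> (nat \<Rightarrow> nat \<Rightarrow> real ^ 'd \<Rightarrow> real ^ 'd) \<Rightarrow>
   (nat \<Rightarrow> nat \<Rightarrow> real) \<Rightarrow> (nat \<Rightarrow> nat \<Rightarrow> real ^ 'd ^ 'd) \<Rightarrow> (nat \<Rightarrow> nat \<Rightarrow> real ^ 'd) \<Rightarrow> bool"
where
  "self_similar_MIFS X N \<phi> r Om \<alpha> \<longleftrightarrow>
     compact X \<and> X \<noteq> {} \<and>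
     (\<forall>n\<ge>1. 2 \<le> N n) \<and>
     (\<forall>n\<ge>1. \<forall>j\<in>{1..N n}.
        r n j \<in> {0<..<1} \<and> orthogonal_matrix (Om n j) \<and>
        (\<forall>x. \<phi> n j x = r n j *\<^sub>R (Om n j *v (x + \<alpha> n j))) \<and>
        \<phi> n j ` X \<subseteq> X) \<and>
     (\<exists>c1 c2 :: nat \<Rightarrow> real.
        (\<forall>n\<ge>1. 0 < c1 n \<and> c1 n \<le> c2 n \<and> c2 n < 1 \<and>
           (\<forall>j\<in>{1..N n}. c1 n \<le> r n j \<and> r n j \<le> c2 n)) \<and>
        (\<lambda>n. \<Prod>i=1..n. c2 i) \<longlonglongrightarrow> 0)"

text \<open>For a word \<open>j\<^sub>0 \<dots> j\<^sub>k\<close> this is the composition of \<open>\<phi> n j\<^sub>0\<close>, \<open>\<phi> (n + 1) j\<^sub>1\<close>, \dots,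
  \<open>\<phi> (n + k) j\<^sub>k\<close>, with the last map applied first.\<close>

fun word_map :: "(nat \<Rightarrow> nat \<Rightarrow> 'a \<Rightarrow> 'a) \<Rightarrow> nat \<Rightarrow> nat list \<Rightarrow> 'a \<Rightarrow> 'a" where
  "word_map \<phi> n [] = id"
| "word_map \<phi> n (j # J) = \<phi> n j \<circ> word_map \<phi> (Suc n) J"

text \<open>The limit set at level \<open>n\<close>, computed from the base point \<open>a\<close>; for a self-similar MIFS
  on \<open>X\<close> it does not depend on the choice of \<open>a \<in> X\<close>.\<close>

definition attractor ::
  "(nat \<Rightarrow> nat) \<Rightarrow> (nat \<Rightarrow> nat \<Rightarrow> 'a \<Rightarrow> 'a) \<Rightarrow> 'a \<Rightarrow> nat \<Rightarrow> 'a::topological_space set"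
where
  "attractor N \<phi> a n =
     {x. \<exists>j. (\<forall>i\<ge>n. j i \<in> {1..N i}) \<and>
             (\<lambda>k. word_map \<phi> n (map j [n..<Suc (n + k)]) a) \<longlonglongrightarrow> x}"

text \<open>Words starting at level 1.  List positions are 0-based, so the entry \<open>J ! i\<close> is a
  symbol of level \<open>Suc i\<close>.\<close>

definition words :: "(nat \<Rightarrow> nat) \<Rightarrow> nat list set" where
  "words N = {J. \<forall>i<length J. J ! i \<in> {1..N (Suc i)}}"

definition word_ratio :: "(nat \<Rightarrow> nat \<Rightarrow> real) \<Rightarrow> nat list \<Rightarrow> real" where
  "word_ratio r J = (\<Prod>i<length J. r (Suc i) (J ! i))"

definition cut_words :: "(nat \<Rightarrow> nat) \<Rightarrow> (nat \<Rightarrow> nat \<Rightarrow> real) \<Rightarrow> real \<Rightarrow> nat list set" where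
  "cut_words N r b =
     {J \<in> words N. J \<noteq> [] \<and> word_ratio r J \<le> b \<and> b < word_ratio r (butlast J)}"

definition cut_maps ::
  "(nat \<Rightarrow> nat) \<Rightarrow> (nat \<Rightarrow> nat \<Rightarrow> 'a \<Rightarrow> 'a) \<Rightarrow> (nat \<Rightarrow> nat \<Rightarrow> real) \<Rightarrow> real \<Rightarrow> ('a \<Rightarrow> 'a) set"
where
  "cut_maps N \<phi> r b = word_map \<phi> 1 ` cut_words N r b"

text \<open>For a self-similar MIFS and \<open>b \<in> {0<..<1}\<close> the set \<open>cut_words N r b\<close> is finite and
  nonempty, so the inner supremum is a maximum and every \<open>card\<close> is taken of a finite set.\<close>

definition MWSC ::
  "(real ^ 'd) set \<Rightarrow> (nat \<Rightarrow> nat) \<Rightarrow> (nat \<Rightarrow> nat \<Rightarrow> real ^ 'd \<Rightarrow> real ^ 'd) \<Rightarrow>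
   (nat \<Rightarrow> nat \<Rightarrow> real) \<Rightarrow> bool"
where
  "MWSC X N \<phi> r \<longleftrightarrow>
     (\<exists>U. (\<forall>n\<ge>1. U n \<in> sets lebesgue \<and> U n \<subseteq> X) \<and>
          0 < (INF n\<in>{1..}. emeasure lebesgue (U n)) \<and>
          (SUP b\<in>{0<..<1}. SUP I\<in>cut_words N r b.
             enat (card {word_map \<phi> 1 J | J. J \<in> cut_words N r b \<and>
               word_map \<phi> 1 J ` U (length J + 1) \<inter> word_map \<phi> 1 I ` U (length I + 1) \<noteq> {}}))
          < \<infinity>)"

text \<open>Least number of sets of diameter at most \<open>\<delta>\<close> needed to cover \<open>E\<close>; meaningful for
  totally bounded \<open>E\<close> and \<open>\<delta> > 0\<close>.  The boundedness condition is needed because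
  \<^const>\<open>diameter\<close> is unspecified on unbounded sets.\<close>

definition covering_number :: "'a::metric_space set \<Rightarrow> real \<Rightarrow> nat" where
  "covering_number E \<delta> =
     (LEAST m. \<exists>\<U>. finite \<U> \<and> card \<U> = m \<and>
        (\<forall>V\<in>\<U>. bounded V \<and> diameter V \<le> \<delta>) \<and> E \<subseteq> \<Union>\<U>)"

definition lower_box_dim :: "'a::metric_space set \<Rightarrow> ereal" where
  "lower_box_dim E =
     Liminf (at_right 0) (\<lambda>\<delta>. ereal (ln (real (covering_number E \<delta>)) / - ln \<delta>))"

definition upper_box_dim :: "'a::metric_space set \<Rightarrow> ereal" where
  "upper_box_dim E =
     Limsup (at_right 0) (\<lambda>\<delta>. ereal (ln (real (covering_number E \<delta>)) / - ln \<delta>))"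

text \<open>Packing dimension through packing measures.  A \<open>\<delta>\<close>-packing of \<open>E\<close> is a countable
  disjoint family of closed balls with centres in \<open>E\<close> and radii at most \<open>\<delta>\<close>, encoded as a set
  of pairs (centre, radius); a ball of radius \<open>\<rho>\<close> has diameter \<open>2 * \<rho>\<close>.\<close>

definition packings :: "'a::euclidean_space set \<Rightarrow> real \<Rightarrow> ('a \<times> real) set set" where
  "packings E \<delta> =
     {C. countable C \<and> (\<forall>(c, \<rho>)\<in>C. c \<in> E \<and> 0 < \<rho> \<and> \<rho> \<le> \<delta>) \<and>
         pairwise (\<lambda>(c, \<rho>) (c', \<rho>'). disjnt (cball c \<rho>) (cball c' \<rho>')) C}"

definition packing_premeasure :: "real \<Rightarrow> 'a::euclidean_space set \<Rightarrow> ennreal" where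
  "packing_premeasure s E =
     (INF \<delta>\<in>{0<..}. SUP C\<in>packings E \<delta>. \<Sum>\<^sub>\<infinity>(c, \<rho>)\<in>C. ennreal ((2 * \<rho>) powr s))"

definition packing_measure :: "real \<Rightarrow> 'a::euclidean_space set \<Rightarrow> ennreal" where
  "packing_measure s E =
     (INF F\<in>{F :: nat \<Rightarrow> 'a set. E \<subseteq> (\<Union>i. F i)}. \<Sum>i. packing_premeasure s (F i))"

definition packing_dim :: "'a::euclidean_space set \<Rightarrow> ereal" where
  "packing_dim E = (INF s\<in>{s. 0 \<le> s \<and> packing_measure s E = 0}. ereal s)"

end

theory Submission
  imports Defs
begin

text \<open>Every cylinder at scale \<open>b\<close> is a similar copy, of ratio at most \<open>b\<close>, of a subset of \<open>X\<close>, so the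
  maps in the cut set at \<open>b\<close> provide a cover of the first attractor by sets of diameter
  \<open>O(b)\<close>.  Conversely, if the ratios of the cut words are at least \<open>\<kappa> b * b\<close>, comparing volumes and
  using the bounded multiplicity of the sets \<open>U\<close> shows that a set of diameter \<open>b\<close> meets at most
  \<open>O(\<kappa> b powr - d)\<close> of the cylinders.  Hence the number of cut maps and the covering number differ by a
  factor of size \<open>exp (o (- ln b))\<close> as soon as \<open>ln (\<kappa> b) / ln b\<close> tends to 0.  In case (i) \<open>\<kappa>\<close> is constant, in
  case (ii) it is at least the ratio of the last letter.  The attractors of different levels have
  comparable covering numbers, and since every cylinder has the full upper box dimension, a Baire
  category argument identifies it with the packing dimension.\<close>

section \<open>Limits of logarithmic ratios and covering numbers\<close>

text \<open>The multiplicity in the separation condition counts maps, not words, so one cut word is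
  fixed for each map before volumes are compared. A cylinder is a similar copy of a later attractor,
  not of the set containing it; comparing covering numbers across levels is what gives all cylinders
  one and the same upper box dimension. The same volume count, applied to all of \<open>X\<close>,
  gives a crude third bound: at most a constant times \<open>(1 / (\<kappa> * b)) ^ d\<close> cut
  maps. It keeps the logarithmic quotient bounded. Case (ii) relies on this: replacing
  \<open>b\<close> by the product of ratios at or just below it leaves the cut maps unchanged and
  alters the denominator by a relatively small amount, and a bounded quotient turns this into a
  vanishing error.\<close>

lemma
  fixes f g :: "'a \<Rightarrow> real"
  assumes lim: "((\<lambda>x. f x - g x) \<longlongrightarrow> 0) F" and F: "F \<noteq> bot"
  shows Liminf_eq_of_diff_tendsto_0: "Liminf F (\<lambda>x. ereal (f x)) = Liminf F (\<lambda>x. ereal (g x))"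
    and Limsup_eq_of_diff_tendsto_0: "Limsup F (\<lambda>x. ereal (f x)) = Limsup F (\<lambda>x. ereal (g x))"
proof -
  have *: "Liminf F (\<lambda>x. ereal (f x)) \<le> Liminf F (\<lambda>x. ereal (g x)) \<and>
      Limsup F (\<lambda>x. ereal (f x)) \<le> Limsup F (\<lambda>x. ereal (g x))"
    if lim: "((\<lambda>x. f x - g x) \<longlongrightarrow> 0) F" for f g :: "'a \<Rightarrow> real"
  proof -
    have "Liminf F (\<lambda>x. ereal (f x)) \<le> Liminf F (\<lambda>x. ereal (g x)) + ereal e \<and>
      Limsup F (\<lambda>x. ereal (f x)) \<le> Limsup F (\<lambda>x. ereal (g x)) + ereal e" if "0 < e" for e
    proof -
      from \<open>0 < e\<close> have "\<forall>\<^sub>F x in F. f x - g x < e"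
        using lim by (auto dest: order_tendstoD)
      then have ev: "\<forall>\<^sub>F x in F. ereal (f x) \<le> ereal (g x) + ereal e"
        by eventually_elim simp
      show ?thesis
        using Liminf_mono[OF ev] Limsup_mono[OF ev] F
          Liminf_add_ereal_right[of F "ereal e" "\<lambda>x. ereal (g x)"]
          Limsup_add_ereal_right[of F "ereal e" "\<lambda>x. ereal (g x)"] by simp
    qed
    then show ?thesis
      by (meson ereal_le_epsilon2)
  qed
  have "((\<lambda>x. g x - f x) \<longlongrightarrow> 0) F"
    using tendsto_minus[OF lim] by simp
  then show "Liminf F (\<lambda>x. ereal (f x)) = Liminf F (\<lambda>x. ereal (g x))"
    "Limsup F (\<lambda>x. ereal (f x)) = Limsup F (\<lambda>x. ereal (g x))"
    using *[of f g] *[of g f] lim by (auto intro: antisym)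
qed

text \<open>Over a linear order \<open>Liminf\<close> is determined by the values that are
  eventually strictly exceeded, and this depends only on the image filter. With
  \<open>f = level\<close> it turns the limit \<open>b\<close> to 0 into a limit along a
  sequence.\<close>

lemma Liminf_compose_filtermap:
  fixes g :: "'b \<Rightarrow> 'c::complete_linorder"
  shows "Liminf F (\<lambda>x. g (f x)) = Liminf (filtermap f F) g"
proof (rule antisym)
  show "Liminf F (\<lambda>x. g (f x)) \<le> Liminf (filtermap f F) g"
    by (simp add: le_Liminf_iff eventually_filtermap less_LiminfD)
qed (rule Liminf_filtermap_le)

lemma Limsup_compose_filtermap:
  fixes g :: "'b \<Rightarrow> 'c::complete_linorder"
  shows "Limsup F (\<lambda>x. g (f x)) = Limsup (filtermap f F) g"
proof (rule antisym)
  show "Limsup (filtermap f F) g \<le> Limsup F (\<lambda>x. g (f x))"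
    by (simp add: Limsup_le_iff eventually_filtermap Limsup_lessD)
qed (rule Limsup_filtermap_ge)

text \<open>Logarithms turn a two-sided factor \<open>A\<close> into the additive error
  \<open>ln A / - ln b\<close>. Every comparison of counts passes through here: with constant
  \<open>A\<close> for attractors of different levels, with a power of \<open>1 / \<kappa>\<close>
  for cut maps.\<close>

lemma
  fixes u v A :: "real \<Rightarrow> real"
  assumes ev: "\<forall>\<^sub>F b in at_right 0. 1 \<le> u b \<and> 1 \<le> v b \<and> u b \<le> A b * v b \<and> v b \<le> A b * u b"
    and A: "((\<lambda>b. ln (A b) / - ln b) \<longlongrightarrow> 0) (at_right 0)"
  shows Liminf_log_ratio_eq: "Liminf (at_right 0) (\<lambda>b. ereal (ln (u b) / - ln b)) =
      Liminf (at_right 0) (\<lambda>b. ereal (ln (v b) / - ln b))"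
    and Limsup_log_ratio_eq: "Limsup (at_right 0) (\<lambda>b. ereal (ln (u b) / - ln b)) =
      Limsup (at_right 0) (\<lambda>b. ereal (ln (v b) / - ln b))"
proof -
  have "\<forall>\<^sub>F b::real in at_right 0. b < 1" "\<forall>\<^sub>F b::real in at_right 0. 0 < b"
    by (auto simp: eventually_at_right_less intro!: eventually_at_rightI[of 0 1])
  with ev have "\<forall>\<^sub>F b in at_right 0. norm (ln (u b) / - ln b - ln (v b) / - ln b) \<le> ln (A b) / - ln b"
  proof eventually_elim
    case (elim b)
    then have "0 < A b"
      by (smt (verit) mult_nonpos_nonneg)
    then have "ln (A b * v b) = ln (A b) + ln (v b)" "ln (A b * u b) = ln (A b) + ln (u b)"
      using elim by (auto intro!: ln_mult_pos)
    moreover have "ln (u b) \<le> ln (A b * v b)" "ln (v b) \<le> ln (A b * u b)"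
      using elim \<open>0 < A b\<close> by auto
    ultimately have "\<bar>ln (u b) - ln (v b)\<bar> \<le> ln (A b)"
      by linarith
    moreover have "- ln b > 0"
      using elim by (simp add: ln_less_zero)
    moreover have "ln (u b) / - ln b - ln (v b) / - ln b = (ln (u b) - ln (v b)) / - ln b"
      by (rule diff_divide_distrib[symmetric])
    ultimately show ?case
      unfolding real_norm_def by (metis abs_divide abs_of_pos divide_right_mono less_imp_le)
  qed
  then have "((\<lambda>b. ln (u b) / - ln b - ln (v b) / - ln b) \<longlongrightarrow> 0) (at_right 0)"
    by (rule Lim_null_comparison[OF _ A])
  from Liminf_eq_of_diff_tendsto_0[OF this] Limsup_eq_of_diff_tendsto_0[OF this]
  show "Liminf (at_right 0) (\<lambda>b. ereal (ln (u b) / - ln b)) =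
      Liminf (at_right 0) (\<lambda>b. ereal (ln (v b) / - ln b))"
    "Limsup (at_right 0) (\<lambda>b. ereal (ln (u b) / - ln b)) =
      Limsup (at_right 0) (\<lambda>b. ereal (ln (v b) / - ln b))"
    by auto
qed

section \<open>Covering numbers under maps and changes of scale\<close>

lemma covering_number_le:
  assumes "finite I" "\<And>i. i \<in> I \<Longrightarrow> bounded (V i)" "\<And>i. i \<in> I \<Longrightarrow> diameter (V i) \<le> \<delta>"
    and "E \<subseteq> (\<Union>i\<in>I. V i)"
  shows "covering_number E \<delta> \<le> card I"
proof -
  have "covering_number E \<delta> \<le> card (V ` I)"
    unfolding covering_number_def
    by (rule Least_le) (use assms in \<open>intro exI[of _ "V ` I"], auto\<close>)
  also have "\<dots> \<le> card I"
    by (simp add: assms card_image_le)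
  finally show ?thesis .
qed

lemma covering_number_witness:
  fixes E :: "'a::euclidean_space set"
  assumes "bounded E" "0 < \<delta>"
  obtains \<U> where "finite \<U>" "card \<U> = covering_number E \<delta>"
    "\<And>V. V \<in> \<U> \<Longrightarrow> bounded V" "\<And>V. V \<in> \<U> \<Longrightarrow> diameter V \<le> \<delta>" "E \<subseteq> \<Union>\<U>"
proof -
  have "seq_compact (closure E)"
    using assms by (simp add: compact_closure flip: compact_eq_seq_compact_metric)
  from seq_compact_imp_totally_bounded[OF this] obtain T where T: "finite T" "closure E \<subseteq> (\<Union>x\<in>T. ball x (\<delta>/2))"
    using half_gt_zero[OF assms(2)] by blast
  have "diameter (ball x (\<delta>/2)) \<le> \<delta>" for x :: 'a
    using assms(2) by (simp add: diameter_ball)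
  then have "\<exists>m \<U>. finite \<U> \<and> card \<U> = m \<and> (\<forall>V\<in>\<U>. bounded V \<and> diameter V \<le> \<delta>) \<and> E \<subseteq> \<Union>\<U>"
    using T closure_subset by (intro exI[of _ "(\<lambda>x. ball x (\<delta>/2)) ` T"] exI) auto
  from LeastI_ex[OF this] show ?thesis
    using that unfolding covering_number_def by blast
qed

lemma covering_number_ge_1:
  fixes E :: "'a::euclidean_space set"
  assumes "bounded E" "0 < \<delta>" "E \<noteq> {}"
  shows "1 \<le> covering_number E \<delta>"
proof -
  obtain \<U> where U: "finite \<U>" "card \<U> = covering_number E \<delta>" "E \<subseteq> \<Union>\<U>"
    using covering_number_witness[OF assms(1,2)] by metis
  have "\<U> \<noteq> {}"
    using U(3) assms(3) by auto
  then show ?thesis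
    using U(1,2) by (metis card_gt_0_iff less_eq_Suc_le One_nat_def)
qed

text \<open>A cover is pulled back rather than pushed forward: the preimages in \<open>E\<close>
  have diameter at most \<open>\<delta>\<close> because \<open>f\<close> shrinks no distance by more
  than the factor \<open>c\<close>. This bounds a set by its similar copy.\<close>

lemma covering_number_pullback:
  fixes f :: "'a::metric_space \<Rightarrow> 'b::euclidean_space"
  assumes "bounded E'" "0 < \<delta>" "0 < c" "f ` E \<subseteq> E'"
    and f: "\<And>x y. x \<in> E \<Longrightarrow> y \<in> E \<Longrightarrow> c * dist x y \<le> dist (f x) (f y)"
  shows "covering_number E \<delta> \<le> covering_number E' (c * \<delta>)"
proof -
  have "0 < c * \<delta>"
    using assms by simp
  then obtain \<U> where U: "finite \<U>" "card \<U> = covering_number E' (c * \<delta>)"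
    "\<And>V. V \<in> \<U> \<Longrightarrow> bounded V" "\<And>V. V \<in> \<U> \<Longrightarrow> diameter V \<le> c * \<delta>" "E' \<subseteq> \<Union>\<U>"
    using covering_number_witness[OF \<open>bounded E'\<close>] by metis
  let ?V = "\<lambda>V. {x\<in>E. f x \<in> V}"
  have d: "dist x y \<le> \<delta>" if "x \<in> ?V V" "y \<in> ?V V" "V \<in> \<U>" for x y V
  proof -
    have "c * dist x y \<le> dist (f x) (f y)"
      using f that by auto
    also have "\<dots> \<le> diameter V"
      using that U(3) by (auto intro: diameter_bounded_bound)
    also have "\<dots> \<le> c * \<delta>"
      using U that by auto
    finally show ?thesis
      using \<open>0 < c\<close> by simp
  qed
  have "bounded (?V V)" if "V \<in> \<U>" for V
    unfolding bounded_two_points using d[OF _ _ that] by blast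
  moreover have "diameter (?V V) \<le> \<delta>" if "V \<in> \<U>" for V
  proof (cases "?V V = {}")
    case False
    then show ?thesis
      unfolding diameter_def using d[OF _ _ that] by (auto intro!: cSUP_least)
  next
    case True
    then show ?thesis
      using \<open>0 < \<delta>\<close> by (simp only: diameter_empty)
  qed
  moreover have "E \<subseteq> (\<Union>V\<in>\<U>. ?V V)"
    using U(5) \<open>f ` E \<subseteq> E'\<close> by blast
  ultimately show ?thesis
    using covering_number_le[OF U(1), of ?V \<delta> E] unfolding U(2) by blast
qed

lemma covering_number_mono:
  fixes E E' :: "'a::euclidean_space set"
  assumes "bounded E'" "0 < \<delta>" "\<delta> \<le> \<delta>'" "E \<subseteq> E'"
  shows "covering_number E \<delta>' \<le> covering_number E' \<delta>"
proof -
  obtain \<U> where U: "finite \<U>" "card \<U> = covering_number E' \<delta>"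
    "\<And>V. V \<in> \<U> \<Longrightarrow> bounded V" "\<And>V. V \<in> \<U> \<Longrightarrow> diameter V \<le> \<delta>" "E' \<subseteq> \<Union>\<U>"
    using covering_number_witness[OF assms(1,2)] by metis
  then show ?thesis
    using covering_number_le[of \<U> "\<lambda>V. V" \<delta>' E] assms by fastforce
qed

text \<open>One optimal cover of \<open>E\<close> is pushed through all the maps; the pairs of index
  and covering set label the resulting cover.\<close>

lemma covering_number_Lipschitz_images:
  fixes E :: "'a::euclidean_space set" and f :: "'i \<Rightarrow> 'a \<Rightarrow> 'b::euclidean_space"
  assumes "bounded E" "0 < \<delta>" "finite I" "E' \<subseteq> (\<Union>i\<in>I. f i ` E)"
    and f: "\<And>i x y. i \<in> I \<Longrightarrow> x \<in> E \<Longrightarrow> y \<in> E \<Longrightarrow> dist (f i x) (f i y) \<le> dist x y"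
  shows "covering_number E' \<delta> \<le> card I * covering_number E \<delta>"
proof -
  obtain \<U> where U: "finite \<U>" "card \<U> = covering_number E \<delta>"
    "\<And>V. V \<in> \<U> \<Longrightarrow> bounded V" "\<And>V. V \<in> \<U> \<Longrightarrow> diameter V \<le> \<delta>" "E \<subseteq> \<Union>\<U>"
    using covering_number_witness[OF assms(1,2)] by metis
  let ?V = "\<lambda>(i, V). f i ` (E \<inter> V)"
  have d: "dist x y \<le> \<delta>" if iV: "iV \<in> I \<times> \<U>" and x: "x \<in> ?V iV" and y: "y \<in> ?V iV" for x y iV
  proof -
    obtain i V where [simp]: "iV = (i, V)"
      by fastforce
    obtain x' y' where x': "x = f i x'" "x' \<in> E" "x' \<in> V" and y': "y = f i y'" "y' \<in> E" "y' \<in> V"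
      using x y by auto
    have "dist x y \<le> dist x' y'"
      using f x' y' iV by auto
    also have "\<dots> \<le> diameter V"
      using x' y' U(3) iV by (auto intro: diameter_bounded_bound)
    also have "\<dots> \<le> \<delta>"
      using iV U by auto
    finally show ?thesis .
  qed
  have "covering_number E' \<delta> \<le> card (I \<times> \<U>)"
  proof (rule covering_number_le[of _ ?V])
    show "bounded (?V iV)" if "iV \<in> I \<times> \<U>" for iV
      unfolding bounded_two_points using d[OF that] by blast
    show "diameter (?V iV) \<le> \<delta>" if "iV \<in> I \<times> \<U>" for iV
      using d[OF that] assms(2) by (intro diameter_le) (auto simp: dist_norm)
    show "E' \<subseteq> (\<Union>iV\<in>I \<times> \<U>. ?V iV)"
    proof
      fix x assume "x \<in> E'"
      then obtain i y where "i \<in> I" "y \<in> E" "x = f i y"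
        using assms(4) by blast
      moreover obtain V where "V \<in> \<U>" "y \<in> V"
        using U(5) \<open>y \<in> E\<close> by blast
      ultimately show "x \<in> (\<Union>iV\<in>I \<times> \<U>. ?V iV)"
        by (intro UN_I[of "(i, V)"]) auto
    qed
  qed (use U assms in auto)
  then show ?thesis
    by (simp add: card_cartesian_product U)
qed

text \<open>A set of diameter \<open>c * \<delta>\<close> lies in a ball of that radius about one of
  its points. This ball is a \<open>\<delta>\<close>-scaled translate of \<open>cball 0 c\<close>,
  so one cover of the reference ball by sets of diameter 1 serves all \<open>E\<close> and all
  \<open>\<delta>\<close>.\<close>

lemma covering_number_doubling:
  assumes "0 < c"
  obtains C :: nat where "1 \<le> C" "\<And>(E::'a::euclidean_space set) \<delta>. bounded E \<Longrightarrow> 0 < \<delta> \<Longrightarrow>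
    covering_number E \<delta> \<le> C * covering_number E (c * \<delta>)"
proof -
  define C where "C = covering_number (cball (0::'a) c) 1"
  have "1 \<le> C"
    unfolding C_def by (rule covering_number_ge_1) (use assms in auto)
  moreover have "covering_number E \<delta> \<le> C * covering_number E (c * \<delta>)"
    if E: "bounded E" "0 < \<delta>" for E :: "'a set" and \<delta>
  proof -
    have "0 < c * \<delta>"
      using E assms by simp
    then obtain \<U> where U: "finite \<U>" "card \<U> = covering_number E (c * \<delta>)"
      "\<And>V. V \<in> \<U> \<Longrightarrow> bounded V" "\<And>V. V \<in> \<U> \<Longrightarrow> diameter V \<le> c * \<delta>" "E \<subseteq> \<Union>\<U>"
      using covering_number_witness[OF E(1)] by metis
    obtain \<B> where B: "finite \<B>" "card \<B> = C"
      "\<And>V. V \<in> \<B> \<Longrightarrow> bounded V" "\<And>V. V \<in> \<B> \<Longrightarrow> diameter V \<le> 1" "cball (0::'a) c \<subseteq> \<Union>\<B>"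
      using covering_number_witness[OF bounded_cball zero_less_one] unfolding C_def by metis
    define p where "p V = (SOME x. x \<in> V)" for V :: "'a set"
    let ?V = "\<lambda>(B, V). (\<lambda>x. p V + \<delta> *\<^sub>R x) ` B"
    have "covering_number E \<delta> \<le> card (\<B> \<times> \<U>)"
    proof (rule covering_number_le[of _ ?V])
      show "bounded (?V BV)" if "BV \<in> \<B> \<times> \<U>" for BV
        using bounded_translation[OF bounded_scaling[OF B(3)[of "fst BV"], of \<delta>], of "p (snd BV)"] that
        by (auto simp: image_image)
      show "diameter (?V BV) \<le> \<delta>" if "BV \<in> \<B> \<times> \<U>" for BV
      proof (rule diameter_le)
        fix x y assume "x \<in> ?V BV" "y \<in> ?V BV"
        then obtain x' y' where x': "x = p (snd BV) + \<delta> *\<^sub>R x'" "x' \<in> fst BV"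
          and y': "y = p (snd BV) + \<delta> *\<^sub>R y'" "y' \<in> fst BV"
          by (auto split: prod.splits)
        have "norm (x - y) = \<delta> * dist x' y'"
          using x' y' \<open>0 < \<delta>\<close> by (simp add: dist_norm flip: scaleR_diff_right)
        also have "\<dots> \<le> \<delta> * diameter (fst BV)"
          using B(3) x' y' that \<open>0 < \<delta>\<close> by (auto intro!: diameter_bounded_bound)
        also have "\<dots> \<le> \<delta> * 1"
          using B(4) that \<open>0 < \<delta>\<close> by (intro mult_left_mono) auto
        finally show "norm (x - y) \<le> \<delta>"
          by simp
      qed (use \<open>0 < \<delta>\<close> in auto)
      show "E \<subseteq> (\<Union>BV\<in>\<B> \<times> \<U>. ?V BV)"
      proof
        fix x assume "x \<in> E"
        then obtain V where V: "V \<in> \<U>" "x \<in> V"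
          using U by auto
        then have "p V \<in> V"
          unfolding p_def by (metis someI_ex)
        then have "dist (p V) x \<le> c * \<delta>"
          using diameter_bounded_bound[of V "p V" x] U V by force
        moreover define y where "y = (1 / \<delta>) *\<^sub>R (x - p V)"
        ultimately have "y \<in> cball 0 c"
          using E(2) by (simp add: dist_norm norm_minus_commute pos_divide_le_eq del: scaleR_diff_right)
        then obtain B where "B \<in> \<B>" "y \<in> B"
          using B(5) by blast
        moreover have "x = p V + \<delta> *\<^sub>R y"
          using E(2) by (simp add: y_def)
        ultimately have "x \<in> ?V (B, V)"
          by blast
        then show "x \<in> (\<Union>BV\<in>\<B> \<times> \<U>. ?V BV)"
          using \<open>B \<in> \<B>\<close> V by blast
      qed
    qed (rule finite_cartesian_product[OF B(1) U(1)])
    then show ?thesis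
      by (simp add: card_cartesian_product U(2) B(2))
  qed
  ultimately show ?thesis
    using that by blast
qed

section \<open>Packing premeasures and the upper box dimension\<close>

lemma tendsto_const_over_neg_ln: "((\<lambda>b::real. c / - ln b) \<longlongrightarrow> 0) (at_right 0)"
proof -
  have "filterlim (\<lambda>b::real. - ln b) at_top (at_right 0)"
    using ln_at_0 by (simp add: filterlim_uminus_at_top)
  then show ?thesis
    by (intro tendsto_divide_0[OF tendsto_const] filterlim_at_top_imp_at_infinity)
qed

lemma eventually_at_right_0_less: "0 < (e::real) \<Longrightarrow> \<forall>\<^sub>F b in at_right 0. 0 < b \<and> b < e"
  by (rule eventually_at_rightI[of 0 e]) auto

lemma upper_box_dim_leI:
  assumes "\<forall>\<^sub>F \<delta> in at_right 0. 1 \<le> covering_number E \<delta> \<and> real (covering_number E \<delta>) \<le> C * \<delta> powr - s"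
  shows "upper_box_dim E \<le> ereal s"
proof -
  have "\<forall>\<^sub>F \<delta> in at_right 0. ereal (ln (real (covering_number E \<delta>)) / - ln \<delta>) \<le> ereal (s + ln C / - ln \<delta>)"
    using assms eventually_at_right_0_less[OF zero_less_one]
  proof eventually_elim
    case (elim \<delta>)
    then have "0 < C * \<delta> powr - s"
      by linarith
    then have "0 < C"
      using elim by (simp add: zero_less_mult_iff)
    have "ln (real (covering_number E \<delta>)) \<le> ln (C * \<delta> powr - s)"
      using elim by simp
    also have "\<dots> = ln C + s * - ln \<delta>"
      using \<open>0 < C\<close> elim by (simp add: ln_mult_pos ln_powr)
    finally have "ln (real (covering_number E \<delta>)) / - ln \<delta> \<le> (ln C + s * - ln \<delta>) / - ln \<delta>"
      using elim by (intro divide_right_mono) auto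
    also have "\<dots> = s + ln C / - ln \<delta>"
      using elim by (simp add: field_simps)
    finally show ?case
      by simp
  qed
  then have "upper_box_dim E \<le> Limsup (at_right 0) (\<lambda>\<delta>. ereal (s + ln C / - ln \<delta>))"
    unfolding upper_box_dim_def by (rule Limsup_mono)
  also have "((\<lambda>\<delta>. s + ln C / - ln \<delta>) \<longlongrightarrow> s + 0) (at_right 0)"
    by (intro tendsto_add tendsto_const tendsto_const_over_neg_ln)
  then have "Limsup (at_right 0) (\<lambda>\<delta>. ereal (s + ln C / - ln \<delta>)) = ereal s"
    by (intro lim_imp_Limsup) auto
  finally show ?thesis .
qed

lemma upper_box_dim_lessD:
  fixes E :: "'a::euclidean_space set"
  assumes "upper_box_dim E < ereal t" "bounded E" "E \<noteq> {}"
  shows "\<forall>\<^sub>F \<delta> in at_right 0. real (covering_number E \<delta>) \<le> \<delta> powr - t"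
  using Limsup_lessD[OF assms(1)[unfolded upper_box_dim_def]] eventually_at_right_0_less[OF zero_less_one]
proof eventually_elim
  case (elim \<delta>)
  have N: "1 \<le> covering_number E \<delta>"
    using covering_number_ge_1 assms elim by blast
  have "ln (real (covering_number E \<delta>)) < t * - ln \<delta>"
    using elim by (simp only: ereal_less_eq less_ereal.simps pos_divide_less_eq[of "- ln \<delta>"] neg_0_less_iff_less ln_less_zero_iff)
  also have "\<dots> = ln (\<delta> powr - t)"
    using elim by (simp add: ln_powr)
  finally have "real (covering_number E \<delta>) < \<delta> powr - t"
    using N elim by (subst (asm) ln_less_cancel_iff) auto
  then show ?case
    by simp
qed

lemma upper_box_dim_nonneg:
  fixes E :: "'a::euclidean_space set"
  assumes "bounded E" "E \<noteq> {}"
  shows "0 \<le> upper_box_dim E"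
proof -
  have "\<forall>\<^sub>F \<delta> in at_right 0. 0 \<le> ereal (ln (real (covering_number E \<delta>)) / - ln \<delta>)"
    using eventually_at_right_0_less[OF zero_less_one]
  proof eventually_elim
    case (elim \<delta>)
    then have "1 \<le> covering_number E \<delta>"
      using covering_number_ge_1 assms by blast
    then have "0 \<le> ln (real (covering_number E \<delta>)) / - ln \<delta>"
      using elim by (intro divide_nonneg_pos) auto
    then show ?case
      by simp
  qed
  then show ?thesis
    unfolding upper_box_dim_def by (intro le_Limsup) auto
qed

lemma finite_subset_packing: "C \<in> packings E \<delta> \<Longrightarrow> F \<subseteq> C \<Longrightarrow> F \<in> packings E \<delta>"
  unfolding packings_def by (auto intro: countable_subset pairwise_mono)

text \<open>A sum of nonnegative terms is the supremum of its finite partial sums, and finite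
  subfamilies of packings are packings. One \<open>\<delta>\<close> is enough because the premeasure
  is an infimum over \<open>\<delta>\<close>.\<close>

lemma packing_premeasure_le:
  assumes "0 < \<delta>" and B: "\<And>F. finite F \<Longrightarrow> F \<in> packings E \<delta> \<Longrightarrow> (\<Sum>(c, \<rho>)\<in>F. (2 * \<rho>) powr s) \<le> B"
  shows "packing_premeasure s E \<le> ennreal B"
proof -
  have "(\<Sum>\<^sub>\<infinity>(c, \<rho>)\<in>C. ennreal ((2 * \<rho>) powr s)) \<le> ennreal B" if "C \<in> packings E \<delta>" for C
  proof -
    have "(\<Sum>(c, \<rho>)\<in>F. ennreal ((2 * \<rho>) powr s)) \<le> ennreal B" if "finite F" "F \<subseteq> C" for F
    proof -
      have "(\<Sum>(c, \<rho>)\<in>F. ennreal ((2 * \<rho>) powr s)) = ennreal (\<Sum>(c, \<rho>)\<in>F. (2 * \<rho>) powr s)"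
        by (simp add: case_prod_unfold sum_ennreal)
      also have "\<dots> \<le> ennreal B"
        using B[OF that(1) finite_subset_packing[OF \<open>C \<in> packings E \<delta>\<close> that(2)]] by (rule ennreal_leI)
      finally show ?thesis .
    qed
    then show ?thesis
      by (subst nonneg_infsum_complete) (auto intro!: SUP_least)
  qed
  then show ?thesis
    unfolding packing_premeasure_def using assms(1)
    by (intro INF_lower2[of \<delta>]) (auto intro!: SUP_least)
qed

text \<open>Pigeonhole: two centres in one covering set are closer than either radius, so the second
  centre would lie in both balls.\<close>

lemma card_packing_le_covering_number:
  fixes E :: "'a::euclidean_space set"
  assumes "F \<in> packings E \<delta>" "bounded E" "0 < d" "\<And>c \<rho>. (c, \<rho>) \<in> F \<Longrightarrow> d < \<rho>"
  shows "card F \<le> covering_number E d"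
proof -
  obtain \<U> where U: "finite \<U>" "card \<U> = covering_number E d"
    "\<And>V. V \<in> \<U> \<Longrightarrow> bounded V" "\<And>V. V \<in> \<U> \<Longrightarrow> diameter V \<le> d" "E \<subseteq> \<Union>\<U>"
    using covering_number_witness[OF assms(2,3)] by metis
  have "\<exists>V. V \<in> \<U> \<and> fst x \<in> V" if "x \<in> F" for x
    using that assms(1) U(5) unfolding packings_def by fastforce
  then obtain g where g: "\<And>x. x \<in> F \<Longrightarrow> g x \<in> \<U> \<and> fst x \<in> g x"
    by metis
  have "inj_on g F"
  proof (rule inj_onI, rule ccontr)
    fix x y assume xy: "x \<in> F" "y \<in> F" "g x = g y" "x \<noteq> y"
    have "dist (fst x) (fst y) \<le> diameter (g x)"
      using g[OF xy(1)] g[OF xy(2)] xy(3) U(3) by (intro diameter_bounded_bound) auto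
    also have "\<dots> \<le> d"
      using g[OF xy(1)] U(4) by auto
    also have "d < snd x"
      using assms(4) xy(1) by (metis prod.collapse)
    finally have "fst y \<in> cball (fst x) (snd x)"
      by simp
    moreover have "0 < snd y"
      using xy(2) assms(3,4) by (metis less_trans prod.collapse)
    then have "fst y \<in> cball (fst y) (snd y)"
      by simp
    moreover have "disjnt (cball (fst x) (snd x)) (cball (fst y) (snd y))"
      using assms(1) xy unfolding packings_def pairwise_def by (auto simp: case_prod_unfold)
    ultimately show False
      by (meson disjnt_iff)
  qed
  then show ?thesis
    using card_inj_on_le[of g F \<U>] g U(1,2) by (metis image_subsetI)
qed

lemma sum_powers_le_geometric_tail:
  fixes q :: real
  assumes "0 \<le> q" "q < 1" "finite S" "\<And>k. k \<in> S \<Longrightarrow> m \<le> k"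
  shows "(\<Sum>k\<in>S. q ^ k) \<le> q ^ m / (1 - q)"
proof -
  have "(\<Sum>k\<in>S. q ^ k) = (\<Sum>k\<in>S. q ^ m * q ^ (k - m))"
    using assms(4) by (intro sum.cong) (auto simp flip: power_add)
  also have "\<dots> = q ^ m * (\<Sum>i\<in>(\<lambda>k. k - m) ` S. q ^ i)"
    using assms(4) by (subst sum.reindex) (auto simp: sum_distrib_left inj_on_def intro: eq_diff_iff[THEN iffD1])
  also have "\<dots> \<le> q ^ m * (\<Sum>i. q ^ i)"
    using assms by (intro mult_left_mono sum_le_suminf) (auto simp: summable_geometric)
  also have "\<dots> = q ^ m / (1 - q)"
    using assms by (simp add: suminf_geometric)
  finally show ?thesis .
qed

text \<open>Dyadic grouping of the radii: a packing has at most \<open>2 powr ((k + 1) * t)\<close> balls with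
  radius in the \<open>k\<close>-th dyadic interval, where \<open>t\<close> lies between the upper box dimension and \<open>s\<close>.\<close>

lemma packing_premeasure_eq_0:
  fixes E :: "'a::euclidean_space set"
  assumes "upper_box_dim E < ereal s" "bounded E" "E \<noteq> {}"
  shows "packing_premeasure s E = 0"
proof -
  obtain t where t: "upper_box_dim E < ereal t" "t < s"
    using ereal_dense2[OF assms(1)] by auto
  have "0 \<le> t"
    using upper_box_dim_nonneg[OF assms(2,3)] t(1) by (metis ereal_less_eq(5) less_imp_le order_trans)
  obtain \<delta>1 where \<delta>1: "0 < \<delta>1" "\<And>\<delta>. 0 < \<delta> \<Longrightarrow> \<delta> < \<delta>1 \<Longrightarrow> real (covering_number E \<delta>) \<le> \<delta> powr - t"
    using upper_box_dim_lessD[OF t(1) assms(2,3)] unfolding eventually_at_right_field by auto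
  \<comment> \<open>In the dyadic class \<open>k\<close> there are at most
    \<open>2 powr ((k + 1) * t)\<close> balls, each contributing at most
    \<open>2 powr ((1 - k) * s)\<close>. The product is \<open>2 powr (s + t) * q ^ k\<close>, and
    \<open>t < s\<close> makes the series geometric; \<open>D\<close> collects the remaining
    constants.\<close>
  define q where "q = 2 powr (t - s)"
  have q: "0 \<le> q" "q < 1"
    using t powr_less_mono[of "t - s" 0 2] by (auto simp: q_def)
  define D where "D = 2 powr (s + t) / (1 - q)"
  have bound: "packing_premeasure s E \<le> ennreal (D * q ^ m)" if m: "(1/2) ^ m < \<delta>1" for m
  proof (rule packing_premeasure_le)
    show "0 < (1/2::real) ^ m"
      by simp
    fix F assume F: "finite F" "F \<in> packings E ((1/2) ^ m)"
    \<comment> \<open>Radii are at most \<open>(1/2) ^ m\<close>, so the floor is at least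
      \<open>m\<close> and the truncation by \<open>nat\<close> loses nothing.\<close>
    define k where "k \<rho> = nat \<lfloor>- log 2 \<rho>\<rfloor>" for \<rho> :: real
    have rad: "m \<le> k \<rho> \<and> 2 powr - (real (k \<rho>) + 1) < \<rho> \<and> \<rho> \<le> 2 powr - real (k \<rho>)"
      if "(c, \<rho>) \<in> F" for c \<rho>
    proof -
      have \<rho>: "0 < \<rho>" "\<rho> \<le> (1/2) ^ m"
        using F(2) that unfolding packings_def by auto
      have "log 2 \<rho> \<le> log 2 ((1/2) ^ m)"
        using \<rho> by simp
      also have "\<dots> = - real m"
        by (simp add: log_nat_power log_divide)
      finally have lm: "real m \<le> - log 2 \<rho>"
        by simp
      then have fl: "int m \<le> \<lfloor>- log 2 \<rho>\<rfloor>"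
        by (simp add: le_floor_iff)
      then have k: "real (k \<rho>) = of_int \<lfloor>- log 2 \<rho>\<rfloor>"
        unfolding k_def by simp
      have "- (real (k \<rho>) + 1) < log 2 \<rho>" "log 2 \<rho> \<le> - real (k \<rho>)"
        unfolding k by linarith+
      then show ?thesis
        using \<rho> fl by (auto simp: k_def less_log_iff log_le_iff)
    qed
    have card: "real (card {x \<in> F. k (snd x) = i}) \<le> 2 powr ((real i + 1) * t)" if "m \<le> i" for i
    proof -
      \<comment> \<open>Strictly below every radius in class \<open>i\<close>, as the pigeonhole
        bound demands.\<close>
      let ?d = "2 powr - (real i + 1) :: real"
      have "card {x \<in> F. k (snd x) = i} \<le> covering_number E ?d"
        using rad by (intro card_packing_le_covering_number[OF finite_subset_packing[OF F(2)] assms(2)]) auto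
      also have "?d < \<delta>1"
      proof -
        have "?d \<le> 2 powr - real m"
          using that by (intro powr_mono) auto
        also have "\<dots> = (1/2) ^ m"
          by (simp add: powr_minus powr_realpow power_one_over inverse_eq_divide)
        finally show ?thesis
          using m by simp
      qed
      then have "real (covering_number E ?d) \<le> ?d powr - t"
        by (intro \<delta>1(2)) auto
      also have "?d powr - t = 2 powr ((real i + 1) * t)"
        by (simp add: powr_powr algebra_simps)
      finally show ?thesis
        by simp
    qed
    have "(\<Sum>(c, \<rho>)\<in>F. (2 * \<rho>) powr s) = (\<Sum>i\<in>(k \<circ> snd) ` F. \<Sum>x\<in>{x \<in> F. k (snd x) = i}. (2 * snd x) powr s)"
      using sum.image_gen[OF F(1), of "\<lambda>x. (2 * snd x) powr s" "k \<circ> snd"] by (simp add: case_prod_unfold)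
    also have "\<dots> \<le> (\<Sum>i\<in>(k \<circ> snd) ` F. 2 powr (s + t) * q ^ i)"
    proof (rule sum_mono)
      fix i assume "i \<in> (k \<circ> snd) ` F"
      then have i: "m \<le> i"
        using rad by (auto simp: comp_def)
      have "(\<Sum>x\<in>{x \<in> F. k (snd x) = i}. (2 * snd x) powr s) \<le> (\<Sum>x\<in>{x \<in> F. k (snd x) = i}. (2 * 2 powr - real i) powr s)"
      proof (rule sum_mono)
        fix x assume x: "x \<in> {x \<in> F. k (snd x) = i}"
        then have "snd x \<le> 2 powr - real i" "0 < snd x"
          using rad[of "fst x" "snd x"] by (auto intro: le_less_trans[OF powr_ge_zero])
        then show "(2 * snd x) powr s \<le> (2 * 2 powr - real i) powr s"
          using \<open>0 \<le> t\<close> t(2) by (intro powr_mono2) auto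
      qed
      also have "\<dots> = real (card {x \<in> F. k (snd x) = i}) * 2 powr ((1 - real i) * s)"
      proof -
        have "2 * 2 powr - real i = 2 powr (1 - real i)"
          by (simp add: powr_mult_base)
        then show ?thesis
          by (simp add: powr_powr)
      qed
      also have "\<dots> \<le> 2 powr ((real i + 1) * t) * 2 powr ((1 - real i) * s)"
        using card[OF i] by (intro mult_right_mono) auto
      also have "\<dots> = 2 powr (s + t) * q ^ i"
        by (simp add: q_def powr_powr flip: powr_add powr_realpow) (simp add: algebra_simps)
      finally show "(\<Sum>x\<in>{x \<in> F. k (snd x) = i}. (2 * snd x) powr s) \<le> 2 powr (s + t) * q ^ i" .
    qed
    also have "\<dots> = 2 powr (s + t) * (\<Sum>i\<in>(k \<circ> snd) ` F. q ^ i)"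
      by (simp add: sum_distrib_left)
    also have "\<dots> \<le> 2 powr (s + t) * (q ^ m / (1 - q))"
      using rad F(1) q by (intro mult_left_mono sum_powers_le_geometric_tail) (auto simp: comp_def)
    also have "\<dots> = D * q ^ m"
      by (simp add: D_def)
    finally show "(\<Sum>(c, \<rho>)\<in>F. (2 * \<rho>) powr s) \<le> D * q ^ m" .
  qed
  have "(\<lambda>m. D * q ^ m) \<longlonglongrightarrow> D * 0"
    using q by (intro tendsto_mult tendsto_const LIMSEQ_realpow_zero)
  then have "(\<lambda>m. ennreal (D * q ^ m)) \<longlonglongrightarrow> ennreal 0"
    by (intro tendsto_ennrealI) simp
  moreover have "(\<lambda>m. (1/2::real) ^ m) \<longlonglongrightarrow> 0"
    by (intro LIMSEQ_realpow_zero) auto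
  then have "\<forall>\<^sub>F m in sequentially. (1/2) ^ m < \<delta>1"
    using \<delta>1(1) by (rule order_tendstoD)
  then have "\<forall>\<^sub>F m in sequentially. packing_premeasure s E \<le> ennreal (D * q ^ m)"
    by eventually_elim (rule bound)
  ultimately have "packing_premeasure s E \<le> ennreal 0"
    by (intro tendsto_lowerbound) auto
  then show ?thesis
    by simp
qed

text \<open>For \<open>s\<close> above the upper box dimension the premeasure of \<open>E\<close>
  already vanishes, so the constant sequence \<open>E\<close> is a cover witnessing measure
  zero.\<close>

lemma packing_dim_le_upper_box_dim:
  fixes E :: "'a::euclidean_space set"
  assumes "bounded E" "E \<noteq> {}"
  shows "packing_dim E \<le> upper_box_dim E"
proof (rule ccontr)
  assume "\<not> packing_dim E \<le> upper_box_dim E"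
  then obtain s where s: "upper_box_dim E < ereal s" "ereal s < packing_dim E"
    using ereal_dense2[of "upper_box_dim E" "packing_dim E"] by (auto simp: not_le)
  have "packing_measure s E \<le> (\<Sum>i::nat. packing_premeasure s E)"
    unfolding packing_measure_def by (rule INF_lower) auto
  then have "packing_measure s E = 0"
    using packing_premeasure_eq_0[OF s(1) assms] by simp
  moreover have "0 \<le> s"
    using upper_box_dim_nonneg[OF assms] s(1) by (metis ereal_less_eq(5) less_imp_le order_trans)
  ultimately have "packing_dim E \<le> ereal s"
    unfolding packing_dim_def by (intro INF_lower) auto
  then show False
    using s(2) by simp
qed

text \<open>Points at mutual distance above \<open>2 * \<rho>\<close> carry disjoint balls of equal
  radius \<open>\<rho>\<close>, so finite premeasure bounds their number by a multiple of
  \<open>(2 * \<rho>) powr - s\<close>. A separated set of largest cardinality therefore exists, and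
  the balls of radius \<open>2 * \<rho>\<close> about it cover \<open>G\<close>.\<close>

lemma upper_box_dim_le_of_packing_premeasure:
  fixes G :: "'a::euclidean_space set"
  assumes "packing_premeasure s G < \<infinity>" "bounded G" "G \<noteq> {}"
  shows "upper_box_dim G \<le> ereal s"
proof -
  obtain \<delta>0 where \<delta>0: "0 < \<delta>0" "(SUP C\<in>packings G \<delta>0. \<Sum>\<^sub>\<infinity>(c, \<rho>)\<in>C. ennreal ((2 * \<rho>) powr s)) < \<infinity>"
    using assms(1) unfolding packing_premeasure_def INF_less_iff by auto
  then obtain M where M: "0 \<le> M" "(SUP C\<in>packings G \<delta>0. \<Sum>\<^sub>\<infinity>(c, \<rho>)\<in>C. ennreal ((2 * \<rho>) powr s)) = ennreal M"
    by (metis ennreal_cases infinity_ennreal_def less_irrefl)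
  have sep: "real (card T) \<le> M * (2 * \<rho>) powr - s"
    if T: "finite T" "T \<subseteq> G" "pairwise (\<lambda>x y. 2 * \<rho> < dist x y) T" and \<rho>: "0 < \<rho>" "\<rho> \<le> \<delta>0" for T \<rho>
  proof -
    have "T \<times> {\<rho>} \<in> packings G \<delta>0"
      unfolding packings_def
    proof (intro CollectI conjI)
      show "pairwise (\<lambda>(c, \<rho>) (c', \<rho>'). disjnt (cball c \<rho>) (cball c' \<rho>')) (T \<times> {\<rho>})"
      proof (rule pairwiseI)
        fix x y assume "x \<in> T \<times> {\<rho>}" "y \<in> T \<times> {\<rho>}" "x \<noteq> y"
        then obtain c c' where c: "x = (c, \<rho>)" "y = (c', \<rho>)" "c \<in> T" "c' \<in> T" "c \<noteq> c'"
          by auto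
        then have "2 * \<rho> < dist c c'"
          using T(3) by (auto simp: pairwise_def)
        then have "cball c \<rho> \<inter> cball c' \<rho> = {}"
          by (intro disjoint_cballI) simp
        then show "(case x of (c, \<rho>) \<Rightarrow> \<lambda>(c', \<rho>'). disjnt (cball c \<rho>) (cball c' \<rho>')) y"
          by (simp add: c disjnt_def)
      qed
    qed (use T \<rho> in \<open>auto intro: countable_finite\<close>)
    then have "(\<Sum>\<^sub>\<infinity>(c, \<rho>)\<in>T \<times> {\<rho>}. ennreal ((2 * \<rho>) powr s)) \<le> ennreal M"
      unfolding M(2)[symmetric] by (rule SUP_upper)
    also have "(\<Sum>\<^sub>\<infinity>(c, \<rho>)\<in>T \<times> {\<rho>}. ennreal ((2 * \<rho>) powr s)) = (\<Sum>x\<in>T \<times> {\<rho>}. ennreal ((2 * \<rho>) powr s))"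
      unfolding infsum_finite[OF finite_cartesian_product[OF T(1) finite.insertI[OF finite.emptyI]]]
      by (intro sum.cong) auto
    also have "\<dots> = ennreal (real (card T) * (2 * \<rho>) powr s)"
      by (simp add: card_cartesian_product ennreal_mult ennreal_of_nat_eq_real_of_nat)
    finally have "real (card T) * (2 * \<rho>) powr s \<le> M"
      using M(1) by (simp add: ennreal_le_iff)
    then show ?thesis
      using \<rho>(1) by (simp add: powr_minus field_simps)
  qed
  have "real (covering_number G (4 * \<rho>)) \<le> M * (2 * \<rho>) powr - s" if \<rho>: "0 < \<rho>" "\<rho> \<le> \<delta>0" for \<rho>
  proof -
    define P where "P T \<longleftrightarrow> finite T \<and> T \<subseteq> G \<and> pairwise (\<lambda>x y. 2 * \<rho> < dist x y) T" for T
    have "P {}"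
      by (simp add: P_def)
    moreover have "card T < Suc (nat \<lfloor>M * (2 * \<rho>) powr - s\<rfloor>)" if "P T" for T
      using sep[of T \<rho>] that \<rho> unfolding P_def by (simp add: less_Suc_eq_le le_nat_floor)
    ultimately obtain T where T: "P T" "\<And>T'. P T' \<Longrightarrow> card T' \<le> card T"
      using ex_has_greatest_nat[of P "{}" card] by (metis less_imp_le_nat)
    have "G \<subseteq> (\<Union>c\<in>T. cball c (2 * \<rho>))"
    proof
      fix x assume x: "x \<in> G"
      show "x \<in> (\<Union>c\<in>T. cball c (2 * \<rho>))"
      proof (rule ccontr)
        assume "x \<notin> (\<Union>c\<in>T. cball c (2 * \<rho>))"
        then have far: "2 * \<rho> < dist c x" if "c \<in> T" for c
          using that by force
        then have "x \<notin> T"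
          using \<rho>(1) by fastforce
        moreover have "P (insert x T)"
          using T(1) x far unfolding P_def by (auto simp: pairwise_insert dist_commute)
        ultimately show False
          using T(2)[of "insert x T"] T(1) unfolding P_def by simp
      qed
    qed
    then have "covering_number G (4 * \<rho>) \<le> card T"
      using T(1) \<rho>(1) unfolding P_def
      by (intro covering_number_le[of T "\<lambda>c. cball c (2 * \<rho>)"]) (auto simp: diameter_cball)
    then show ?thesis
      using sep[of T \<rho>] T(1) \<rho> unfolding P_def by linarith
  qed
  note cov = this
  have "\<forall>\<^sub>F \<delta> in at_right 0. 0 < \<delta> \<and> \<delta> < 4 * \<delta>0"
    using \<delta>0(1) by (intro eventually_at_right_0_less) simp
  then show ?thesis
  \<comment> \<open>The estimate is used at \<open>\<rho> = \<delta> / 4\<close>, where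
    \<open>2 * \<rho> = \<delta> / 2\<close>; this accounts for the factor
    \<open>(1/2) powr - s\<close>.\<close>
  proof (intro upper_box_dim_leI[of _ "M * (1/2) powr - s"], eventually_elim)
    case (elim \<delta>)
    have "real (covering_number G \<delta>) \<le> M * (\<delta> / 2) powr - s"
      using cov[of "\<delta> / 4"] elim by simp
    also have "(\<delta> / 2) powr - s = (1/2) powr - s * \<delta> powr - s"
      using elim by (simp flip: powr_mult)
    finally show ?case
      using covering_number_ge_1[OF assms(2) _ assms(3)] elim by (simp add: mult.assoc)
  qed
qed

text \<open>An infimum equal to 0 admits a cover with sum below 1, which makes each term finite. The
  value 1 is arbitrary: only finiteness of the premeasures enters the category argument.\<close>

lemma packing_measure_eq_0_cover:
  assumes "packing_measure s E = 0"
  obtains F :: "nat \<Rightarrow> 'a::euclidean_space set"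
  where "E \<subseteq> (\<Union>i. F i)" "\<And>i. packing_premeasure s (F i) < \<infinity>"
proof -
  have "packing_measure s E < 1"
    using assms by simp
  then obtain F :: "nat \<Rightarrow> 'a set" where F: "E \<subseteq> (\<Union>i. F i)" "(\<Sum>i. packing_premeasure s (F i)) < 1"
    unfolding packing_measure_def INF_less_iff by auto
  have "packing_premeasure s (F i) < \<infinity>" for i
  proof -
    have "packing_premeasure s (F i) \<le> (\<Sum>i. packing_premeasure s (F i))"
      using sum_le_suminf[of "\<lambda>i. packing_premeasure s (F i)" "{i}"] by simp
    also have "\<dots> < 1"
      by (rule F)
    finally show ?thesis
      by (metis ennreal_one_less_top less_trans infinity_ennreal_def)
  qed
  then show ?thesis
    using F that by blast
qed

lemma packing_premeasure_mono: "E \<subseteq> E' \<Longrightarrow> packing_premeasure s E \<le> packing_premeasure s E'"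
  unfolding packing_premeasure_def packings_def
  by (intro INF_mono') (rule SUP_subset_mono, auto)

section \<open>Volumes of similar copies\<close>

text \<open>The library states these facts only over well-ordered index types.  Balls are mapped to balls
  of the same radius, and by Vitali's theorem a box is, up to a null set, a disjoint union of balls.\<close>

lemma measure_orthogonal_image_cbox:
  fixes f :: "'a::euclidean_space \<Rightarrow> 'a"
  assumes f: "orthogonal_transformation f"
  shows "measure lebesgue (f ` cbox a b) = measure lebesgue (cbox a b)"
proof -
  define K where "K = {(c, \<rho>). 0 < \<rho> \<and> ball c \<rho> \<subseteq> box a b}"
  have "\<exists>i. i \<in> K \<and> x \<in> ball (fst i) (snd i) \<and> snd i < d" if x: "x \<in> box a b" "0 < d" for x and d :: real
  proof -
    obtain e where e: "0 < e" "ball x e \<subseteq> box a b"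
      using openE[OF open_box x(1)] by blast
    have "ball x (min e (d / 2)) \<subseteq> box a b"
      using subset_ball[of "min e (d / 2)" e x] e(2) by simp
    then have "(x, min e (d / 2)) \<in> K"
      using e(1) x(2) by (simp add: K_def)
    then show ?thesis
      using e(1) x(2) by (intro exI[of _ "(x, min e (d / 2))"]) simp
  qed
  from Vitali_covering_theorem_balls[of "box a b" K fst snd, OF this]
  obtain C where C: "countable C" "C \<subseteq> K"
    and disj: "pairwise (\<lambda>i j. disjnt (ball (fst i) (snd i)) (ball (fst j) (snd j))) C"
    and neg: "negligible (box a b - (\<Union>i\<in>C. ball (fst i) (snd i)))"
    by blast
  let ?B = "\<lambda>i. ball (fst i) (snd i)"
  define U where "U = (\<Union>i\<in>C. ?B i)"
  have inK: "0 < snd i \<and> ?B i \<subseteq> box a b" if "i \<in> C" for i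
    using subsetD[OF C(2) that] unfolding K_def by (simp add: case_prod_unfold)
  then have U: "U \<subseteq> cbox a b"
    using box_subset_cbox unfolding U_def by blast
  have "negligible ((cbox a b - box a b) \<union> (box a b - U))"
    using neg negligible_frontier_interval unfolding U_def by (rule negligible_Un[rotated])
  then have N: "negligible (cbox a b - U)"
    by (rule negligible_subset) blast
  have fN: "negligible (f ` (cbox a b - U))"
    using N linear_imp_differentiable_on[OF orthogonal_transformation_linear[OF f]]
    by (rule negligible_differentiable_image_negligible[OF order_refl])
  have inj: "inj f"
    using f by (rule orthogonal_transformation_inj)
  have fB: "f ` ?B i = ball (f (fst i)) (snd i)" for i
    using f by (rule image_orthogonal_transformation_ball)
  have "disjoint_family_on ?B C" 
    using disj unfolding disjoint_family_on_def pairwise_def disjnt_def by blast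
  moreover from this have "disjoint_family_on (\<lambda>i. f ` ?B i) C"
    unfolding disjoint_family_on_def by (simp flip: image_Int[OF inj])
  moreover have "emeasure lebesgue (f ` ?B i) = emeasure lebesgue (?B i)" if "i \<in> C" for i
    using inK[OF that] emeasure_lebesgue_ball_conv_unit_ball[of "snd i" "fst i"]
      emeasure_lebesgue_ball_conv_unit_ball[of "snd i" "f (fst i)"] unfolding fB by simp
  ultimately have "emeasure lebesgue (\<Union>i\<in>C. f ` ?B i) = emeasure lebesgue (\<Union>i\<in>C. ?B i)"
    using C(1) fB
    by (simp add: emeasure_UN_countable) (rule nn_integral_cong, simp)
  moreover have "emeasure lebesgue (U \<union> (cbox a b - U)) = emeasure lebesgue U"
    using C(1) N unfolding U_def negligible_iff_null_sets
    by (intro emeasure_Un_null_set sets.countable_UN'') auto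
  moreover have "emeasure lebesgue (f ` U \<union> f ` (cbox a b - U)) = emeasure lebesgue (f ` U)"
    using C(1) fN unfolding U_def negligible_iff_null_sets image_UN fB
    by (intro emeasure_Un_null_set sets.countable_UN'') auto
  ultimately have "emeasure lebesgue (f ` U \<union> f ` (cbox a b - U)) = emeasure lebesgue (U \<union> (cbox a b - U))"
    unfolding U_def image_UN by presburger
  moreover have "U \<union> (cbox a b - U) = cbox a b" "f ` U \<union> f ` (cbox a b - U) = f ` cbox a b"
    using U by auto
  ultimately show ?thesis
    by (simp add: measure_def)
qed

text \<open>\<open>measure_linear_sufficient\<close> reduces a linear map to its effect on boxes,
  where the orthogonal part preserves volume and the scaling contributes the power of
  \<open>\<rho>\<close>. The translation acts before the linear part, as in
  \<open>\<phi>\<close>.\<close>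

lemma
  fixes f :: "'a::euclidean_space \<Rightarrow> 'a"
  assumes f: "orthogonal_transformation f" and S: "S \<in> lmeasurable"
  shows lmeasurable_similarity_image: "(\<lambda>x. \<rho> *\<^sub>R f (x + c)) ` S \<in> lmeasurable"
    and measure_similarity_image: "measure lebesgue ((\<lambda>x. \<rho> *\<^sub>R f (x + c)) ` S) = \<bar>\<rho>\<bar> ^ DIM('a) * measure lebesgue S"
proof -
  have lin: "linear (\<lambda>x. \<rho> *\<^sub>R f x)"
    using f by (simp add: linear_compose_scale_right orthogonal_transformation_linear)
  have "measure lebesgue ((\<lambda>x. \<rho> *\<^sub>R f x) ` cbox a b) = \<bar>\<rho>\<bar> ^ DIM('a) * measure lebesgue (cbox a b)" for a b
    using measure_lebesgue_affine[of \<rho> 0 "f ` cbox a b"] measure_orthogonal_image_cbox[OF f, of a b]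
    by (simp add: image_image)
  moreover have "(\<lambda>x. c + x) ` S \<in> lmeasurable"
    using S by (rule measurable_translation)
  ultimately have "(\<lambda>x. \<rho> *\<^sub>R f x) ` (\<lambda>x. c + x) ` S \<in> lmeasurable \<and>
      \<bar>\<rho>\<bar> ^ DIM('a) * measure lebesgue ((\<lambda>x. c + x) ` S) = measure lebesgue ((\<lambda>x. \<rho> *\<^sub>R f x) ` (\<lambda>x. c + x) ` S)"
    by (intro measure_linear_sufficient[OF lin])
  then show "(\<lambda>x. \<rho> *\<^sub>R f (x + c)) ` S \<in> lmeasurable"
    "measure lebesgue ((\<lambda>x. \<rho> *\<^sub>R f (x + c)) ` S) = \<bar>\<rho>\<bar> ^ DIM('a) * measure lebesgue S"
    using measure_translation[of c S] by (simp_all add: image_image add.commute)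
qed

section \<open>Words, addresses and attractors\<close>

text \<open>Starting levels vary because cylinders are extended and addresses are cut in the middle.
  The recursion raises the level with each letter, in step with \<open>word_map\<close>;
  \<open>words\<close> and \<open>word_ratio\<close> are the case \<open>n = 1\<close>.\<close>

fun word_from :: "(nat \<Rightarrow> nat) \<Rightarrow> nat \<Rightarrow> nat list \<Rightarrow> bool" where
  "word_from N n [] \<longleftrightarrow> True"
| "word_from N n (j # J) \<longleftrightarrow> j \<in> {1..N n} \<and> word_from N (Suc n) J"

fun ratio_from :: "(nat \<Rightarrow> nat \<Rightarrow> real) \<Rightarrow> nat \<Rightarrow> nat list \<Rightarrow> real" where
  "ratio_from r n [] = 1"
| "ratio_from r n (j # J) = r n j * ratio_from r (Suc n) J"

lemma word_from_iff_nth: "word_from N n J \<longleftrightarrow> (\<forall>i<length J. J ! i \<in> {1..N (n + i)})"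
proof (induction J arbitrary: n)
  case (Cons j J)
  show ?case
    unfolding word_from.simps Cons.IH length_Cons All_less_Suc2 by simp
qed simp

lemma ratio_from_eq_prod: "ratio_from r n J = (\<Prod>i<length J. r (n + i) (J ! i))"
  by (induction J arbitrary: n) (simp_all add: prod.lessThan_Suc_shift del: prod.lessThan_Suc)

lemma words_eq: "words N = {J. word_from N 1 J}"
  unfolding words_def word_from_iff_nth by simp

lemma word_ratio_eq: "word_ratio r J = ratio_from r 1 J"
  unfolding word_ratio_def ratio_from_eq_prod by simp

lemma word_map_append: "word_map \<phi> n (I @ J) = word_map \<phi> n I \<circ> word_map \<phi> (n + length I) J"
  by (induction I arbitrary: n) (simp_all add: comp_assoc)

lemma word_from_append: "word_from N n (I @ J) \<longleftrightarrow> word_from N n I \<and> word_from N (n + length I) J"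
  by (induction I arbitrary: n) simp_all

lemma ratio_from_append: "ratio_from r n (I @ J) = ratio_from r n I * ratio_from r (n + length I) J"
  by (induction I arbitrary: n) simp_all

lemma finite_words_from: "finite {J. word_from N n J \<and> length J \<le> m}"
proof (rule finite_subset)
  let ?A = "\<Union>i\<le>m. {1..N (n + i)}"
  show "{J. word_from N n J \<and> length J \<le> m} \<subseteq> {J. set J \<subseteq> ?A \<and> length J \<le> m}"
  proof (intro subsetI CollectI conjI)
    fix J j assume "J \<in> {J. word_from N n J \<and> length J \<le> m}"
    then have J: "word_from N n J" "length J \<le> m"
      by auto
    show "length J \<le> m"
      by (rule J)
    assume "j \<in> set J"
    then obtain i where "i < length J" "j = J ! i"
      by (auto simp: in_set_conv_nth)
    then show "j \<in> ?A"
      using J unfolding word_from_iff_nth by (intro UN_I[of i]) auto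
  qed
  show "finite {J. set J \<subseteq> ?A \<and> length J \<le> m}"
    by (rule finite_lists_length_le) simp
qed

definition address :: "(nat \<Rightarrow> nat) \<Rightarrow> nat \<Rightarrow> (nat \<Rightarrow> nat) \<Rightarrow> bool" where
  "address N n j \<longleftrightarrow> (\<forall>i\<ge>n. j i \<in> {1..N i})"

definition prefix_from :: "nat \<Rightarrow> (nat \<Rightarrow> nat) \<Rightarrow> nat \<Rightarrow> nat list" where
  "prefix_from n j k = map j [n..<n + k]"

lemma length_prefix_from [simp]: "length (prefix_from n j k) = k"
  by (simp add: prefix_from_def)

lemma prefix_from_0 [simp]: "prefix_from n j 0 = []"
  by (simp add: prefix_from_def)

lemma prefix_from_add: "prefix_from n j (k + l) = prefix_from n j k @ prefix_from (n + k) j l"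
  unfolding prefix_from_def using upt_add_eq_append[of n "n + k" l] by (simp add: add.assoc)

lemma prefix_from_Suc: "prefix_from n j (Suc k) = prefix_from n j k @ [j (n + k)]"
  by (simp add: prefix_from_def)

lemma word_from_prefix: "address N n j \<Longrightarrow> word_from N n (prefix_from n j k)"
  by (auto simp: address_def word_from_iff_nth prefix_from_def)

lemma address_shift: "address N n j \<Longrightarrow> address N (n + k) j"
  by (simp add: address_def)

text \<open>The definition of \<open>attractor\<close> runs over prefixes of \<open>k + 1\<close>
  letters, \<open>prefix_from\<close> over \<open>k\<close> letters; the shift of index does not
  affect the limit.\<close>

lemma attractor_iff:
  "x \<in> attractor N \<phi> a n \<longleftrightarrow> (\<exists>j. address N n j \<and> (\<lambda>k. word_map \<phi> n (prefix_from n j k) a) \<longlonglongrightarrow> x)"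
proof -
  have "(\<lambda>k. word_map \<phi> n (map j [n..<Suc (n + k)]) a) \<longlonglongrightarrow> x \<longleftrightarrow>
      (\<lambda>k. word_map \<phi> n (prefix_from n j k) a) \<longlonglongrightarrow> x" for j
    using filterlim_sequentially_Suc[of "\<lambda>k. word_map \<phi> n (prefix_from n j k) a" "nhds x"]
    unfolding prefix_from_def add_Suc_right .
  then show ?thesis
    unfolding attractor_def address_def by simp
qed

section \<open>Similarity estimates and the coding of attractors by addresses\<close>

locale MIFS =
  fixes X :: "(real ^ 'd) set" and N \<phi> r Om \<alpha> a
  assumes mifs: "self_similar_MIFS X N \<phi> r Om \<alpha>" and a_in_X: "a \<in> X"
begin

abbreviation "K \<equiv> attractor N \<phi> a"
abbreviation "W \<equiv> word_map \<phi>"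

lemma r_bounds: "1 \<le> n \<Longrightarrow> j \<in> {1..N n} \<Longrightarrow> 0 < r n j \<and> r n j < 1"
  using mifs unfolding self_similar_MIFS_def greaterThanLessThan_iff by blast

lemma \<phi>_eq: "1 \<le> n \<Longrightarrow> j \<in> {1..N n} \<Longrightarrow> \<phi> n j = (\<lambda>x. r n j *\<^sub>R (Om n j *v (x + \<alpha> n j)))"
  using mifs unfolding self_similar_MIFS_def by blast

lemma orthogonal_Om: "1 \<le> n \<Longrightarrow> j \<in> {1..N n} \<Longrightarrow> orthogonal_transformation ((*v) (Om n j))"
  using mifs unfolding self_similar_MIFS_def orthogonal_transformation_matrix matrix_of_matrix_vector_mul
  by (blast intro: matrix_vector_mul_linear)

lemma \<phi>_image_X: "1 \<le> n \<Longrightarrow> j \<in> {1..N n} \<Longrightarrow> \<phi> n j ` X \<subseteq> X"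
  using mifs unfolding self_similar_MIFS_def by blast

lemma N_ge_2: "1 \<le> n \<Longrightarrow> 2 \<le> N n"
  using mifs unfolding self_similar_MIFS_def by blast

lemma compact_X: "compact X"
  using mifs unfolding self_similar_MIFS_def by blast

text \<open>The added 1 makes the bound positive even for a single point, so that scales can be
  divided by it.\<close>

definition D :: real where "D = diameter X + 1"

lemma D_pos: "0 < D"
  unfolding D_def using diameter_ge_0[OF compact_imp_bounded[OF compact_X]] by linarith

lemma dist_le_D: "x \<in> X \<Longrightarrow> y \<in> X \<Longrightarrow> dist x y \<le> D"
  unfolding D_def using diameter_bounded_bound[OF compact_imp_bounded[OF compact_X]] by fastforce

lemma dist_\<phi>:
  assumes "1 \<le> n" "j \<in> {1..N n}"
  shows "dist (\<phi> n j x) (\<phi> n j y) = r n j * dist x y"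
proof -
  have "\<phi> n j x - \<phi> n j y = r n j *\<^sub>R (Om n j *v (x - y))"
    using assms by (simp add: \<phi>_eq flip: scaleR_diff_right matrix_vector_mult_diff_distrib)
  then show ?thesis
    using r_bounds[OF assms] orthogonal_transformation_norm[OF orthogonal_Om[OF assms], of "x - y"]
    by (simp add: dist_norm)
qed

lemma ratio_from_pos: "1 \<le> n \<Longrightarrow> word_from N n J \<Longrightarrow> 0 < ratio_from r n J"
proof (induction J arbitrary: n)
  case (Cons j J)
  then show ?case
    using r_bounds[of n j] by simp
qed simp

lemma ratio_from_le_1: "1 \<le> n \<Longrightarrow> word_from N n J \<Longrightarrow> ratio_from r n J \<le> 1"
proof (induction J arbitrary: n)
  case (Cons j J)
  then have "r n j * ratio_from r (Suc n) J \<le> 1 * 1"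
    using r_bounds[of n j] ratio_from_pos[of "Suc n" J] by (intro mult_mono) auto
  then show ?case
    by simp
qed simp

lemma dist_word_map:
  "1 \<le> n \<Longrightarrow> word_from N n J \<Longrightarrow> dist (W n J x) (W n J y) = ratio_from r n J * dist x y"
  by (induction J arbitrary: n) (simp_all add: dist_\<phi>)

lemma word_map_in_X: "1 \<le> n \<Longrightarrow> word_from N n J \<Longrightarrow> x \<in> X \<Longrightarrow> W n J x \<in> X"
proof (induction J arbitrary: n)
  case (Cons j J)
  then show ?case
    using \<phi>_image_X[of n j] by (auto simp: image_subset_iff)
qed simp

lemma tendsto_word_map:
  assumes "1 \<le> n" "word_from N n J" "(f \<longlongrightarrow> y) F"
  shows "((\<lambda>k. W n J (f k)) \<longlongrightarrow> W n J y) F"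
proof -
  have "((\<lambda>k. ratio_from r n J * dist (f k) y) \<longlongrightarrow> ratio_from r n J * 0) F"
    using assms(3) by (intro tendsto_mult tendsto_const) (simp flip: tendsto_dist_iff)
  then show ?thesis
    by (subst tendsto_dist_iff) (simp add: dist_word_map[OF assms(1,2)])
qed

text \<open>The bounds \<open>c2\<close> do not depend on the letter, so the threshold
  \<open>k0\<close> serves all words at once. The assumption on the system concerns products from
  level 1; dividing by the product \<open>Q\<close> over the levels below \<open>n\<close> transfers
  it to words starting at \<open>n\<close>.\<close>

lemma ratio_from_small:
  assumes "1 \<le> n" "0 < e"
  obtains k0 where "\<And>J. word_from N n J \<Longrightarrow> k0 \<le> length J \<Longrightarrow> ratio_from r n J < e"
proof -
  obtain c1 c2 where c: "\<forall>n\<ge>1. 0 < c1 n \<and> c1 n \<le> c2 n \<and> c2 n < 1 \<and>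
           (\<forall>j\<in>{1..N n}. c1 n \<le> r n j \<and> r n j \<le> c2 n)"
    and lim: "(\<lambda>n. \<Prod>i=1..n. c2 i) \<longlonglongrightarrow> 0"
    using mifs unfolding self_similar_MIFS_def by (elim conjE exE) (rule that)
  have c2: "0 < c2 i" if "1 \<le> i" for i
    using c[rule_format, OF that] by linarith
  have le: "ratio_from r m J \<le> (\<Prod>i=m..<m + length J. c2 i)" if "1 \<le> m" "word_from N m J" for m J
    using that
  proof (induction J arbitrary: m)
    case (Cons j J)
    have "r m j * ratio_from r (Suc m) J \<le> c2 m * (\<Prod>i=Suc m..<Suc m + length J. c2 i)"
      using Cons.prems Cons.IH[of "Suc m"] c[rule_format, of m] c2[of m] ratio_from_pos[of "Suc m" J]
      by (intro mult_mono) (auto simp del: prod.op_ivl_Suc)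
    also have "\<dots> = (\<Prod>i=m..<m + length (j # J). c2 i)"
      using prod.atLeast_Suc_lessThan[of m "m + length (j # J)" c2] by simp
    finally show ?case
      by simp
  qed simp
  define Q where "Q = (\<Prod>i=1..<n. c2 i)"
  have "0 < Q"
    unfolding Q_def by (intro prod_pos) (auto intro: c2)
  then have "\<forall>\<^sub>F m in sequentially. (\<Prod>i=1..m. c2 i) < e * Q"
    using lim assms by (intro order_tendstoD) auto
  then obtain k0 where k0: "\<And>m. k0 \<le> m \<Longrightarrow> (\<Prod>i=1..m. c2 i) < e * Q"
    unfolding eventually_sequentially by blast
  have "ratio_from r n J < e" if J: "word_from N n J" "Suc k0 \<le> length J" for J
  proof -
    have "Q * ratio_from r n J \<le> Q * (\<Prod>i=n..<n + length J. c2 i)"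
      using le[OF assms(1) J(1)] \<open>0 < Q\<close> by (intro mult_left_mono) auto
    also have "\<dots> = (\<Prod>i=1..<n + length J. c2 i)"
      unfolding Q_def using assms by (intro prod.atLeastLessThan_concat) auto
    also have "{1..<n + length J} = {1..n + length J - 1}"
      using assms by auto
    also have "(\<Prod>i\<in>\<dots>. c2 i) < e * Q"
      using J by (intro k0) auto
    finally show ?thesis
      using \<open>0 < Q\<close> by (simp add: mult.commute)
  qed
  then show ?thesis
    using that by blast
qed

text \<open>All prefixes with at least \<open>k0\<close> letters begin with the same word
  \<open>P\<close>, so the corresponding points lie in the image of \<open>X\<close> under
  \<open>W n P\<close>, whose diameter is below \<open>e\<close>.\<close>

lemma word_map_prefix_convergent:
  assumes "1 \<le> n" "address N n j"
  shows "convergent (\<lambda>k. W n (prefix_from n j k) a)"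
proof (intro Cauchy_convergent metric_CauchyI)
  fix e :: real assume "0 < e"
  then have "0 < e / D"
    using D_pos by simp
  then obtain k0 where k0: "\<And>J. word_from N n J \<Longrightarrow> k0 \<le> length J \<Longrightarrow> ratio_from r n J < e / D"
    using ratio_from_small[OF assms(1)] by blast
  define P where "P = prefix_from n j k0"
  have P: "word_from N n P" "ratio_from r n P < e / D"
    unfolding P_def using k0 word_from_prefix[OF assms(2)] by auto
  have mem: "\<exists>x\<in>X. W n (prefix_from n j m) a = W n P x" if "k0 \<le> m" for m
  proof -
    have "W n (prefix_from n j m) = W n P \<circ> W (n + k0) (prefix_from (n + k0) j (m - k0))"
      using prefix_from_add[of n j k0 "m - k0"] that word_map_append[of \<phi> n P] by (simp add: P_def)
    then show ?thesis
      using word_map_in_X[OF trans_le_add1[OF assms(1)] word_from_prefix[OF address_shift[OF assms(2)]] a_in_X]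
      by (intro bexI[of _ "W (n + k0) (prefix_from (n + k0) j (m - k0)) a"]) (auto simp only: comp_apply)
  qed
  show "\<exists>M. \<forall>m\<ge>M. \<forall>n'\<ge>M. dist (W n (prefix_from n j m) a) (W n (prefix_from n j n') a) < e"
  proof (intro exI allI impI)
    fix m n' assume "k0 \<le> m" "k0 \<le> n'"
    then obtain x y where "x \<in> X" "y \<in> X" "W n (prefix_from n j m) a = W n P x" "W n (prefix_from n j n') a = W n P y"
      using mem by meson
    then have "dist (W n (prefix_from n j m) a) (W n (prefix_from n j n') a) \<le> ratio_from r n P * D"
      using dist_word_map[OF assms(1) P(1)] ratio_from_pos[OF assms(1) P(1)] dist_le_D by simp
    also have "\<dots> < e"
      using P(2) D_pos by (simp add: pos_less_divide_eq)
    finally show "dist (W n (prefix_from n j m) a) (W n (prefix_from n j n') a) < e" .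
  qed
qed

text \<open>The tail of the address converges to a point \<open>y\<close> of the later attractor;
  continuity of the prefix map and uniqueness of limits identify its image with
  \<open>x\<close>.\<close>

lemma address_point_eq:
  assumes "1 \<le> n" "address N n j" "(\<lambda>k. W n (prefix_from n j k) a) \<longlonglongrightarrow> x"
  obtains y where "y \<in> K (n + k)" "x = W n (prefix_from n j k) y"
proof -
  obtain y where y: "(\<lambda>l. W (n + k) (prefix_from (n + k) j l) a) \<longlonglongrightarrow> y"
    using word_map_prefix_convergent[OF trans_le_add1[OF assms(1)] address_shift[OF assms(2)]]
    unfolding convergent_def by blast
  have "(\<lambda>l. W n (prefix_from n j k) (W (n + k) (prefix_from (n + k) j l) a)) \<longlonglongrightarrow> W n (prefix_from n j k) y"
    using y by (intro tendsto_word_map assms word_from_prefix)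
  moreover have "(\<lambda>l. W n (prefix_from n j (l + k)) a) \<longlonglongrightarrow> x"
    using assms(3) by (rule LIMSEQ_ignore_initial_segment)
  ultimately have "x = W n (prefix_from n j k) y"
    unfolding add.commute[of _ k] prefix_from_add word_map_append length_prefix_from comp_apply
    by (rule LIMSEQ_unique[rotated])
  moreover have "y \<in> K (n + k)"
    using y address_shift[OF assms(2)] attractor_iff by blast
  ultimately show ?thesis
    using that by blast
qed

text \<open>Prepending \<open>J\<close> to an address of \<open>y\<close> gives an address of
  \<open>W n J y\<close>.\<close>

lemma word_map_attractor:
  assumes "1 \<le> n" "word_from N n J" "y \<in> K (n + length J)"
  shows "W n J y \<in> K n"
proof -
  obtain j where j: "address N (n + length J) j" "(\<lambda>k. W (n + length J) (prefix_from (n + length J) j k) a) \<longlonglongrightarrow> y"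
    using assms(3) unfolding attractor_iff by blast
  \<comment> \<open>Addresses are indexed by level and words by position, hence the shift by
    \<open>n\<close>.\<close>
  define j' where "j' i = (if i < n + length J then J ! (i - n) else j i)" for i
  have "address N n j'"
    unfolding address_def
  proof (intro allI impI)
    fix i assume i: "n \<le> i"
    show "j' i \<in> {1..N i}"
    proof (cases "i < n + length J")
      case True
      then have "i - n < length J" "n + (i - n) = i"
        using i by auto
      then have "J ! (i - n) \<in> {1..N i}"
        using assms(2) unfolding word_from_iff_nth by metis
      then show ?thesis
        using True by (simp add: j'_def)
    next
      case False
      then show ?thesis
        using j(1) by (simp add: j'_def address_def)
    qed
  qed
  have pre: "prefix_from n j' (length J + k) = J @ prefix_from (n + length J) j k" for k
    by (rule nth_equalityI) (auto simp: prefix_from_def nth_append j'_def)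
  have "(\<lambda>k. W n J (W (n + length J) (prefix_from (n + length J) j k) a)) \<longlonglongrightarrow> W n J y"
    using j(2) by (intro tendsto_word_map assms)
  then have "(\<lambda>k. W n (prefix_from n j' (k + length J)) a) \<longlonglongrightarrow> W n J y"
    unfolding add.commute[of _ "length J"] pre word_map_append comp_apply .
  then have "(\<lambda>k. W n (prefix_from n j' k) a) \<longlonglongrightarrow> W n J y"
    by (rule LIMSEQ_offset)
  then show ?thesis
    using \<open>address N n j'\<close> unfolding attractor_iff by blast
qed

lemma attractor_subset:
  assumes "1 \<le> n"
  shows "K n \<subseteq> X"
proof
  fix x assume "x \<in> K n"
  then obtain j where j: "address N n j" "(\<lambda>k. W n (prefix_from n j k) a) \<longlonglongrightarrow> x"
    unfolding attractor_iff by blast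
  show "x \<in> X"
    using word_map_in_X[OF assms word_from_prefix[OF j(1)] a_in_X]
    by (intro closed_sequentially[OF compact_imp_closed[OF compact_X] _ j(2)]) blast
qed

lemma attractor_bounded: "1 \<le> n \<Longrightarrow> bounded (K n)"
  using attractor_subset compact_imp_bounded[OF compact_X] bounded_subset by blast

lemma attractor_nonempty:
  assumes "1 \<le> n"
  shows "K n \<noteq> {}"
proof -
  have "address N n (\<lambda>_. 1)"
    unfolding address_def using N_ge_2[OF order_trans[OF assms]] by (metis atLeastAtMost_iff le_trans one_le_numeral order_refl)
  then obtain x where "(\<lambda>k. W n (prefix_from n (\<lambda>_. 1) k) a) \<longlonglongrightarrow> x"
    using word_map_prefix_convergent[OF assms] unfolding convergent_def by blast
  then have "x \<in> K n"
    using \<open>address N n (\<lambda>_. 1)\<close> attractor_iff by blast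
  then show ?thesis
    by blast
qed

lemma attractor_mem_word_map:
  assumes "1 \<le> n" "x \<in> K n"
  obtains J y where "word_from N n J" "length J = k" "y \<in> K (n + k)" "x = W n J y"
proof -
  obtain j where j: "address N n j" "(\<lambda>k. W n (prefix_from n j k) a) \<longlonglongrightarrow> x"
    using assms(2) unfolding attractor_iff by blast
  obtain y where "y \<in> K (n + k)" "x = W n (prefix_from n j k) y"
    using address_point_eq[OF assms(1) j] .
  then show ?thesis
    using that[OF word_from_prefix[OF j(1)] length_prefix_from] by blast
qed

subsection \<open>Dimensions of the attractors\<close>

text \<open>Pulling a cover back along the similarity \<open>W n J\<close> enlarges the scale by the
  inverse ratio. The doubling constant for that fixed factor restores the scale, so \<open>C\<close>
  depends on \<open>J\<close> but not on \<open>\<delta>\<close>.\<close>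

lemma covering_number_attractor_le:
  assumes "1 \<le> n" "word_from N n J"
  obtains C :: nat where "1 \<le> C" "\<And>\<delta>. 0 < \<delta> \<Longrightarrow>
    covering_number (K (n + length J)) \<delta> \<le> C * covering_number (W n J ` K (n + length J)) \<delta>"
proof -
  let ?R = "ratio_from r n J"
  have R: "0 < ?R"
    using ratio_from_pos assms by blast
  obtain C :: nat where C: "1 \<le> C" "\<And>(E::(real ^ 'd) set) \<delta>. bounded E \<Longrightarrow> 0 < \<delta> \<Longrightarrow>
    covering_number E \<delta> \<le> C * covering_number E (1 / ?R * \<delta>)"
    using covering_number_doubling[of "1 / ?R"] R by (metis zero_less_divide_1_iff)
  have sub: "W n J ` K (n + length J) \<subseteq> X"
    using attractor_subset assms word_map_attractor by blast
  have bdd: "bounded (W n J ` K (n + length J))" "bounded (K (n + length J))"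
    using sub compact_imp_bounded[OF compact_X] bounded_subset attractor_bounded assms by auto
  have "covering_number (K (n + length J)) \<delta> \<le> C * covering_number (W n J ` K (n + length J)) \<delta>" if "0 < \<delta>" for \<delta>
  proof -
    have "covering_number (K (n + length J)) \<delta> \<le> C * covering_number (K (n + length J)) (1 / ?R * \<delta>)"
      using C(2) bdd that by blast
    also have "\<dots> \<le> C * covering_number (W n J ` K (n + length J)) (?R * (1 / ?R * \<delta>))"
      using R that bdd dist_word_map[OF assms]
      by (intro mult_le_mono2 covering_number_pullback[of _ _ _ "W n J"]) auto
    also have "?R * (1 / ?R * \<delta>) = \<delta>"
      using R by simp
    finally show ?thesis .
  qed
  then show ?thesis
    using C(1) that by blast
qed

text \<open>One word of length \<open>n - 1\<close> places a similar copy of \<open>K n\<close>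
  inside \<open>K 1\<close>; conversely the finitely many words of that length cover
  \<open>K 1\<close> by contracted images of \<open>K n\<close>.\<close>

lemma covering_number_attractor_comparable:
  assumes "1 \<le> n"
  obtains C :: nat where "1 \<le> C" "\<And>\<delta>. 0 < \<delta> \<Longrightarrow> covering_number (K n) \<delta> \<le> C * covering_number (K 1) \<delta>"
    "\<And>\<delta>. 0 < \<delta> \<Longrightarrow> covering_number (K 1) \<delta> \<le> C * covering_number (K n) \<delta>"
proof -
  obtain x where "x \<in> K 1"
    using attractor_nonempty[OF order_refl] by blast
  then obtain J0 where J0: "word_from N 1 J0" "length J0 = n - 1"
    using attractor_mem_word_map[OF order_refl, of x "n - 1"] by blast
  have n: "1 + length J0 = n"
    using J0 assms by simp
  obtain C :: nat where C: "1 \<le> C" "\<And>\<delta>. 0 < \<delta> \<Longrightarrow>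
    covering_number (K n) \<delta> \<le> C * covering_number (W 1 J0 ` K n) \<delta>"
    using covering_number_attractor_le[OF order_refl J0(1)] unfolding n by blast
  define I where "I = {J. word_from N 1 J \<and> length J = n - 1}"
  have I: "finite I"
    unfolding I_def by (rule finite_subset[OF _ finite_words_from[of N 1 "n - 1"]]) auto
  have "W 1 J0 ` K n \<subseteq> K 1"
    using word_map_attractor[OF order_refl J0(1)] n by auto
  then have le1: "covering_number (K n) \<delta> \<le> C * covering_number (K 1) \<delta>" if "0 < \<delta>" for \<delta>
    using C(2)[OF that] covering_number_mono[OF attractor_bounded[OF order_refl] that order_refl, of "W 1 J0 ` K n"]
    by (meson le_trans mult_le_mono2)
  have cover: "K 1 \<subseteq> (\<Union>J\<in>I. W 1 J ` K n)"
  proof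
    fix x assume "x \<in> K 1"
    then obtain J y where "word_from N 1 J" "length J = n - 1" "y \<in> K (1 + (n - 1))" "x = W 1 J y"
      using attractor_mem_word_map[OF order_refl, of x "n - 1"] by blast
    then show "x \<in> (\<Union>J\<in>I. W 1 J ` K n)"
      using assms by (intro UN_I[of J]) (simp_all add: I_def)
  qed
  have lip: "dist (W 1 J x) (W 1 J y) \<le> dist x y" if "J \<in> I" for J x y
  proof -
    have "word_from N 1 J"
      using that by (simp add: I_def)
    then show ?thesis
      using ratio_from_le_1[OF order_refl, of J] ratio_from_pos[OF order_refl, of J]
      by (subst dist_word_map) (auto intro!: mult_left_le_one_le)
  qed
  have le2: "covering_number (K 1) \<delta> \<le> card I * covering_number (K n) \<delta>" if "0 < \<delta>" for \<delta>
    using covering_number_Lipschitz_images[OF attractor_bounded[OF assms] that I cover] lip by blast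
  show ?thesis
  proof
    show "1 \<le> C + card I"
      using C by simp
    show "covering_number (K n) \<delta> \<le> (C + card I) * covering_number (K 1) \<delta>" if "0 < \<delta>" for \<delta>
      using le1[OF that] by (simp add: algebra_simps)
    show "covering_number (K 1) \<delta> \<le> (C + card I) * covering_number (K n) \<delta>" if "0 < \<delta>" for \<delta>
      using le2[OF that] by (simp add: algebra_simps)
  qed
qed

lemma
  assumes "1 \<le> n"
  shows lower_box_dim_attractor_eq: "lower_box_dim (K n) = lower_box_dim (K 1)"
    and upper_box_dim_attractor_eq: "upper_box_dim (K n) = upper_box_dim (K 1)"
proof -
  obtain C :: nat where C: "1 \<le> C" "\<And>\<delta>. 0 < \<delta> \<Longrightarrow> covering_number (K n) \<delta> \<le> C * covering_number (K 1) \<delta>"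
    "\<And>\<delta>. 0 < \<delta> \<Longrightarrow> covering_number (K 1) \<delta> \<le> C * covering_number (K n) \<delta>"
    using covering_number_attractor_comparable[OF assms] by blast
  let ?u = "\<lambda>\<delta>. real (covering_number (K n) \<delta>)" and ?v = "\<lambda>\<delta>. real (covering_number (K 1) \<delta>)"
  have ev: "\<forall>\<^sub>F \<delta> in at_right 0. 1 \<le> ?u \<delta> \<and> 1 \<le> ?v \<delta> \<and> ?u \<delta> \<le> real C * ?v \<delta> \<and> ?v \<delta> \<le> real C * ?u \<delta>"
    using eventually_at_right_0_less[OF zero_less_one]
  proof eventually_elim
    case (elim \<delta>)
    then have \<delta>: "0 < \<delta>"
      by simp
    have "1 \<le> covering_number (K m) \<delta>" if "1 \<le> m" for m
      using that \<delta> by (intro covering_number_ge_1 attractor_bounded attractor_nonempty)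
    moreover have "?u \<delta> \<le> real C * ?v \<delta>" "?v \<delta> \<le> real C * ?u \<delta>"
      unfolding of_nat_mult[symmetric] of_nat_le_iff using C(2,3)[OF \<delta>] .
    ultimately show ?case
      using assms by simp
  qed
  show "lower_box_dim (K n) = lower_box_dim (K 1)" "upper_box_dim (K n) = upper_box_dim (K 1)"
    unfolding lower_box_dim_def upper_box_dim_def
    by (rule Liminf_log_ratio_eq[OF ev tendsto_const_over_neg_ln] Limsup_log_ratio_eq[OF ev tendsto_const_over_neg_ln])+
qed

text \<open>A Baire category argument on addresses: if countably many sets of finite premeasure covered the
  attractor, nested cylinders avoiding the closure of one set after another would lead to an
  uncovered point.\<close>

lemma cylinder_avoiding:
  assumes "packing_premeasure s F < \<infinity>" "ereal s < upper_box_dim (K 1)" "word_from N n J" "1 \<le> n"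
  obtains J' where "J' \<noteq> []" "word_from N n (J @ J')" "W n (J @ J') ` K (n + length (J @ J')) \<inter> F = {}"
proof -
  let ?m = "n + length J"
  define G where "G = F \<inter> W n J ` K ?m"
  have bddX: "bounded X"
    using compact_X by (rule compact_imp_bounded)
  have sub: "W n J ` K ?m \<subseteq> X"
    using attractor_subset assms word_map_attractor by blast
  have G: "bounded G" "packing_premeasure s G < \<infinity>"
    using bounded_subset[OF bounded_subset[OF bddX sub]] le_less_trans[OF packing_premeasure_mono assms(1)]
    unfolding G_def by blast+
  \<comment> \<open>Otherwise \<open>G\<close> would be dense in the cylinder. Taking closures of
    covering sets keeps their diameter, so the cylinder would have covering numbers no larger than
    those of \<open>G\<close>. Its upper box dimension, which is that of \<open>K 1\<close>, would
    then be at most \<open>s\<close> up to an arbitrarily small gap, because \<open>G\<close> has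
    finite premeasure.\<close>
  have "\<not> W n J ` K ?m \<subseteq> closure G"
  proof
    assume dense: "W n J ` K ?m \<subseteq> closure G"
    have ne: "G \<noteq> {}"
      using dense attractor_nonempty[of ?m] assms(4) by auto
    obtain C :: nat where C: "1 \<le> C" "\<And>\<delta>. 0 < \<delta> \<Longrightarrow>
      covering_number (K ?m) \<delta> \<le> C * covering_number (W n J ` K ?m) \<delta>"
      using covering_number_attractor_le[OF assms(4,3)] by blast
    have cov: "covering_number (K ?m) \<delta> \<le> C * covering_number G \<delta>" if \<delta>: "0 < \<delta>" for \<delta>
    proof -
      obtain \<U> where U: "finite \<U>" "card \<U> = covering_number G \<delta>"
        "\<And>V. V \<in> \<U> \<Longrightarrow> bounded V" "\<And>V. V \<in> \<U> \<Longrightarrow> diameter V \<le> \<delta>" "G \<subseteq> \<Union>\<U>"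
        using covering_number_witness[OF G(1) \<delta>] by metis
      have "closure G \<subseteq> (\<Union>V\<in>\<U>. closure V)"
        using U(1,5) closure_subset by (intro closure_minimal closed_UN) blast+
      then have "covering_number (W n J ` K ?m) \<delta> \<le> card \<U>"
        using U dense by (intro covering_number_le[of \<U> closure]) (auto simp: diameter_closure)
      then have "C * covering_number (W n J ` K ?m) \<delta> \<le> C * covering_number G \<delta>"
        unfolding U(2) by (rule mult_le_mono2)
      with C(2)[OF \<delta>] show ?thesis
        by linarith
    qed
    obtain t where t: "s < t" "ereal t < upper_box_dim (K 1)"
      using ereal_dense2[OF assms(2)] by auto
    obtain t' where t': "s < t'" "t' < t"
      using dense_order_class.dense[OF t(1)] by blast
    have "upper_box_dim G < ereal t'"
      using upper_box_dim_le_of_packing_premeasure[OF G(2,1) ne] t'(1) by (metis le_less_trans less_ereal.simps(1))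
    then have "\<forall>\<^sub>F \<delta> in at_right 0. real (covering_number G \<delta>) \<le> \<delta> powr - t'"
      using G(1) ne by (rule upper_box_dim_lessD)
    then have "\<forall>\<^sub>F \<delta> in at_right 0. 1 \<le> covering_number (K ?m) \<delta> \<and> real (covering_number (K ?m) \<delta>) \<le> real C * \<delta> powr - t'"
      using eventually_at_right_0_less[OF zero_less_one]
    proof eventually_elim
      case (elim \<delta>)
      have "real (covering_number (K ?m) \<delta>) \<le> real C * real (covering_number G \<delta>)"
        unfolding of_nat_mult[symmetric] of_nat_le_iff using elim by (intro cov) simp
      also have "\<dots> \<le> real C * \<delta> powr - t'"
        using elim by (intro mult_left_mono) auto
      finally show ?case
        using covering_number_ge_1[OF attractor_bounded _ attractor_nonempty, of ?m \<delta>] elim assms(4) by simp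
    qed
    then have "upper_box_dim (K ?m) \<le> ereal t'"
      by (rule upper_box_dim_leI)
    moreover have "upper_box_dim (K ?m) = upper_box_dim (K 1)"
      using assms(4) by (intro upper_box_dim_attractor_eq) simp
    ultimately show False
      using t(2) t'(2) by (metis ereal_less_eq(3) less_imp_le not_le order_trans)
  qed
  then obtain y where y: "y \<in> K ?m" "W n J y \<notin> closure G"
    by auto
  have "open (- closure G)"
    by blast
  then obtain e where e: "0 < e" "ball (W n J y) e \<subseteq> - closure G"
    using openE[of "- closure G" "W n J y"] y(2) by blast
  obtain k0 where k0: "\<And>J'. word_from N ?m J' \<Longrightarrow> k0 \<le> length J' \<Longrightarrow> ratio_from r ?m J' < e / D"
    using ratio_from_small[OF trans_le_add1[OF assms(4)], of "e / D" "length J"] e(1) D_pos by auto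
  \<comment> \<open>The new letters follow an address of \<open>y\<close>, so the longer cylinder
    still contains \<open>W n J y\<close>. Being smaller than \<open>e\<close> it stays in the ball
    that misses \<open>G\<close>. The length \<open>Suc k0\<close> also makes \<open>J'\<close>
    nonempty.\<close>
  obtain J' z where J': "word_from N ?m J'" "length J' = Suc k0" "z \<in> K (?m + Suc k0)" "y = W ?m J' z"
    using attractor_mem_word_map[OF trans_le_add1[OF assms(4)] y(1)] by blast
  have word: "word_from N n (J @ J')"
    using assms(3) J'(1) by (simp add: word_from_append)
  have "ratio_from r n (J @ J') \<le> 1 * ratio_from r ?m J'"
    unfolding ratio_from_append using ratio_from_le_1[OF assms(4,3)] ratio_from_pos[OF trans_le_add1[OF assms(4)] J'(1)]
    by (intro mult_right_mono) auto
  also have "\<dots> < e / D"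
    using k0[OF J'(1)] J'(2) by simp
  finally have small: "ratio_from r n (J @ J') < e / D" .
  have "W n (J @ J') u \<notin> F" if u: "u \<in> K (n + length (J @ J'))" for u
  proof -
    have "u \<in> K (?m + length J')"
      using u by (simp add: add.assoc)
    then have "W ?m J' u \<in> K ?m"
      using word_map_attractor[OF trans_le_add1[OF assms(4)] J'(1)] by blast
    moreover have eq: "W n (J @ J') v = W n J (W ?m J' v)" for v
      by (simp add: word_map_append)
    ultimately have in_cyl: "W n (J @ J') u \<in> W n J ` K ?m"
      by simp
    have "u \<in> X" "z \<in> X"
      using u J'(3) attractor_subset[of "n + length (J @ J')"] attractor_subset[of "?m + Suc k0"] assms(4) by auto
    have "dist (W n J y) (W n (J @ J') u) = ratio_from r n (J @ J') * dist z u"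
      using dist_word_map[OF assms(4) word, of z u] by (simp add: J'(4) eq)
    also have "\<dots> \<le> ratio_from r n (J @ J') * D"
      using dist_le_D[OF \<open>z \<in> X\<close> \<open>u \<in> X\<close>] ratio_from_pos[OF assms(4) word] by simp
    also have "\<dots> < e"
      using small D_pos by (simp add: pos_less_divide_eq)
    finally have "W n (J @ J') u \<notin> G"
      using subsetD[OF e(2)] subsetD[OF closure_subset[of G]] by (metis ComplD mem_ball)
    then show ?thesis
      using in_cyl by (simp add: G_def)
  qed
  moreover have "J' \<noteq> []"
    using J'(2) by auto
  ultimately show ?thesis
    using that[of J'] word by blast
qed

lemma packing_dim_attractor_eq:
  assumes "1 \<le> n"
  shows "packing_dim (K n) = upper_box_dim (K n)"
proof (rule antisym)
  show "packing_dim (K n) \<le> upper_box_dim (K n)"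
    using assms by (intro packing_dim_le_upper_box_dim attractor_bounded attractor_nonempty)
  show "upper_box_dim (K n) \<le> packing_dim (K n)"
    unfolding packing_dim_def
  proof (rule INF_greatest, rule ccontr)
    fix s assume s: "s \<in> {s. 0 \<le> s \<and> packing_measure s (K n) = 0}" "\<not> upper_box_dim (K n) \<le> ereal s"
    then have lt: "ereal s < upper_box_dim (K 1)"
      using upper_box_dim_attractor_eq[OF assms] by simp
    obtain F :: "nat \<Rightarrow> (real ^ 'd) set" where F: "K n \<subseteq> (\<Union>i. F i)" "\<And>i. packing_premeasure s (F i) < \<infinity>"
      using packing_measure_eq_0_cover[of s "K n"] s(1) by blast
    define cyl where "cyl J = W n J ` K (n + length J)" for J
    \<comment> \<open>Stage \<open>i\<close> removes \<open>F i\<close> and appends at least one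
      letter; the strict growth is what makes the words spell an infinite address.\<close>
    have "\<exists>w. \<forall>i. word_from N n (w i) \<and> (\<exists>J'. J' \<noteq> [] \<and> w (Suc i) = w i @ J' \<and> cyl (w (Suc i)) \<inter> F i = {})"
    proof (rule dependent_nat_choice)
      show "\<exists>J. word_from N n J"
        by (rule exI[of _ "[]"]) simp
      show "\<exists>J''. word_from N n J'' \<and> (\<exists>J'. J' \<noteq> [] \<and> J'' = J @ J' \<and> cyl J'' \<inter> F i = {})"
        if J: "word_from N n J" for J i
      proof -
        obtain J' where "J' \<noteq> []" "word_from N n (J @ J')" "W n (J @ J') ` K (n + length (J @ J')) \<inter> F i = {}"
          using cylinder_avoiding[OF F(2) lt J assms] .
        then show ?thesis
          unfolding cyl_def by (intro exI[of _ "J @ J'"] exI[of _ J'] conjI refl)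
      qed
    qed
    then obtain w where w_all: "\<forall>i. word_from N n (w i) \<and>
        (\<exists>J'. J' \<noteq> [] \<and> w (Suc i) = w i @ J' \<and> cyl (w (Suc i)) \<inter> F i = {})" ..
    have w: "word_from N n (w i)"
      "\<exists>J'. J' \<noteq> [] \<and> w (Suc i) = w i @ J' \<and> cyl (w (Suc i)) \<inter> F i = {}" for i
      using w_all[rule_format, of i] by (rule conjunct1, rule conjunct2)
    have len: "i \<le> length (w i)" for i
    proof (induction i)
      case (Suc i)
      obtain J' where "J' \<noteq> []" "w (Suc i) = w i @ J'"
        using w(2) by blast
      then show ?case
        using Suc by (simp add: Suc_le_eq le_less_trans)
    qed simp
    have ext: "\<exists>J'. w (i + l) = w i @ J'" for i l
    proof (induction l)
      case (Suc l)
      then obtain J' where "w (i + l) = w i @ J'" ..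
      moreover obtain J'' where "w (Suc (i + l)) = w (i + l) @ J''"
        using w(2) by blast
      ultimately show ?case
        by simp
    qed simp
    have nth_eq: "w i ! p = w i' ! p" if "i \<le> i'" "p < length (w i)" for i i' p
    proof -
      obtain J' where "w (i + (i' - i)) = w i @ J'"
        using ext by blast
      then show ?thesis
        using that by (simp add: nth_append)
    qed
    \<comment> \<open>The letter of level \<open>m\<close> stands at position \<open>m - n\<close>.
      The word \<open>w (Suc (m - n))\<close> has at least \<open>m - n + 1\<close> letters, so this
      position exists, and all longer words agree there.\<close>
    define j where "j m = w (Suc (m - n)) ! (m - n)" for m
    have j: "j (n + p) = w i ! p" if "p < length (w i)" for i p
    proof -
      have "w (Suc p) ! p = w i ! p"
      proof (cases "i \<le> Suc p")
        case True
        from nth_eq[OF this that] show ?thesis ..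
      next
        case False
        then show ?thesis
          using len[of "Suc p"] by (intro nth_eq) simp_all
      qed
      then show ?thesis
        by (simp add: j_def)
    qed
    have "j i \<in> {1..N i}" if "n \<le> i" for i
    proof -
      have "i - n < length (w (Suc (i - n)))"
        using len[of "Suc (i - n)"] by simp
      then have "w (Suc (i - n)) ! (i - n) \<in> {1..N (n + (i - n))}"
        using w(1) unfolding word_from_iff_nth by blast
      then show ?thesis
        using that by (simp add: j_def)
    qed
    then have addr: "address N n j"
      by (simp add: address_def)
    have pre: "prefix_from n j (length (w i)) = w i" for i
      by (rule nth_equalityI) (simp_all add: prefix_from_def j)
    obtain x where x: "(\<lambda>k. W n (prefix_from n j k) a) \<longlonglongrightarrow> x"
      using word_map_prefix_convergent[OF assms addr] unfolding convergent_def by blast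
    then have "x \<in> K n"
      using addr attractor_iff by blast
    then obtain i where "x \<in> F i"
      using F(1) by blast
    \<comment> \<open>Each \<open>w i\<close> is a prefix of the address, so cutting the address
      after it exhibits \<open>x\<close> in that cylinder. As \<open>w (Suc i)\<close> was chosen to
      avoid \<open>F i\<close>, this contradicts the cover.\<close>
    moreover have "x \<in> cyl (w (Suc i))"
      using address_point_eq[OF assms addr x, of "length (w (Suc i))"] unfolding pre cyl_def by blast
    ultimately show False
      using w(2)[of i] by blast
  qed
qed

subsection \<open>Cut sets\<close>

lemma cut_words_iff: "J \<in> cut_words N r b \<longleftrightarrow>
    word_from N 1 J \<and> J \<noteq> [] \<and> ratio_from r 1 J \<le> b \<and> b < ratio_from r 1 (butlast J)"
  unfolding cut_words_def words_eq word_ratio_eq by simp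

text \<open>The word without its last letter still has ratio above \<open>b\<close>, so it is
  shorter than the uniform length at which all ratios fall below \<open>b\<close>.\<close>

lemma finite_cut_words:
  assumes "0 < b"
  shows "finite (cut_words N r b)"
proof -
  obtain k0 where k0: "\<And>J. word_from N 1 J \<Longrightarrow> k0 \<le> length J \<Longrightarrow> ratio_from r 1 J < b"
    using ratio_from_small[OF order_refl assms] by blast
  have "word_from N 1 J \<and> length J \<le> k0" if "J \<in> cut_words N r b" for J
  proof -
    have J: "word_from N 1 J" "J \<noteq> []" "b < ratio_from r 1 (butlast J)"
      using that unfolding cut_words_iff by blast+
    then have "word_from N 1 (butlast J)"
      using word_from_append[of N 1 "butlast J" "[last J]"] by simp
    then have "\<not> k0 \<le> length (butlast J)"
      using k0[of "butlast J"] J(3) by auto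
    then show ?thesis
      using J(1) by simp
  qed
  then show ?thesis
    by (intro finite_subset[OF subsetI finite_words_from[of N 1 k0]]) simp
qed

lemma finite_cut_maps: "0 < b \<Longrightarrow> finite (cut_maps N \<phi> r b)"
  unfolding cut_maps_def by (intro finite_imageI finite_cut_words)

text \<open>The shortest prefix with ratio at most \<open>b\<close> is a cut word; it is nonempty
  because the empty word has ratio 1, which exceeds \<open>b\<close>.\<close>

lemma cut_word_prefix:
  assumes "0 < b" "b < 1" "address N 1 j"
  obtains k where "prefix_from 1 j k \<in> cut_words N r b"
proof -
  define P where "P k \<longleftrightarrow> ratio_from r 1 (prefix_from 1 j k) \<le> b" for k
  obtain k0 where "\<And>J. word_from N 1 J \<Longrightarrow> k0 \<le> length J \<Longrightarrow> ratio_from r 1 J < b"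
    using ratio_from_small[OF order_refl assms(1)] by blast
  from this[OF word_from_prefix[OF assms(3)], of k0] have "P k0"
    by (simp add: P_def)
  then have P: "P (Least P)"
    by (rule LeastI)
  have "\<not> P 0"
    using assms by (simp add: P_def)
  then obtain m where m: "Least P = Suc m"
    using P by (metis not0_implies_Suc)
  have "butlast (prefix_from 1 j (Suc m)) = prefix_from 1 j m"
    unfolding prefix_from_Suc by simp
  moreover have "b < ratio_from r 1 (prefix_from 1 j m)"
    using not_less_Least[of m P] unfolding m by (simp add: P_def not_le)
  moreover have "prefix_from 1 j (Suc m) \<noteq> []"
    unfolding prefix_from_Suc by simp
  ultimately have "prefix_from 1 j (Suc m) \<in> cut_words N r b"
    using P word_from_prefix[OF assms(3)] unfolding m P_def cut_words_iff by simp
  then show ?thesis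
    using that by blast
qed

lemma cut_map_image_subset: "f \<in> cut_maps N \<phi> r b \<Longrightarrow> f ` X \<subseteq> X"
proof (rule image_subsetI)
  fix x assume f: "f \<in> cut_maps N \<phi> r b" and x: "x \<in> X"
  obtain J where "f = W 1 J" "word_from N 1 J"
    using f unfolding cut_maps_def image_iff Bex_def cut_words_iff by metis
  then show "f x \<in> X"
    using word_map_in_X[OF order_refl _ x] by simp
qed

lemma cut_map_dist_le:
  assumes "f \<in> cut_maps N \<phi> r b" "x \<in> X" "y \<in> X"
  shows "dist (f x) (f y) \<le> b * D"
proof -
  obtain J where J: "f = W 1 J" "word_from N 1 J" "ratio_from r 1 J \<le> b"
    using assms(1) unfolding cut_maps_def image_iff by (auto simp: cut_words_iff)
  then have "dist (f x) (f y) = ratio_from r 1 J * dist x y"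
    using dist_word_map by simp
  also have "\<dots> \<le> b * D"
    using J dist_le_D assms(2,3) ratio_from_pos[OF order_refl J(2)] by (intro mult_mono) auto
  finally show ?thesis .
qed

lemma attractor_subset_cut_maps:
  assumes "0 < b" "b < 1"
  shows "K 1 \<subseteq> (\<Union>f\<in>cut_maps N \<phi> r b. f ` X)"
proof
  fix x assume "x \<in> K 1"
  then obtain j where j: "address N 1 j" "(\<lambda>k. W 1 (prefix_from 1 j k) a) \<longlonglongrightarrow> x"
    unfolding attractor_iff by blast
  obtain k where k: "prefix_from 1 j k \<in> cut_words N r b"
    using cut_word_prefix[OF assms j(1)] .
  obtain y where "y \<in> K (1 + k)" "x = W 1 (prefix_from 1 j k) y"
    using address_point_eq[OF order_refl j] .
  moreover have "y \<in> X"
    using attractor_subset[of "1 + k"] \<open>y \<in> K (1 + k)\<close> by auto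
  ultimately show "x \<in> (\<Union>f\<in>cut_maps N \<phi> r b. f ` X)"
    using k unfolding cut_maps_def by blast
qed

lemma covering_number_le_card_cut_maps:
  assumes "0 < b" "b < 1"
  shows "covering_number (K 1) (b * D) \<le> card (cut_maps N \<phi> r b)"
proof (rule covering_number_le[OF finite_cut_maps[OF assms(1)] _ _ attractor_subset_cut_maps[OF assms]])
  fix f assume f: "f \<in> cut_maps N \<phi> r b"
  show "bounded (f ` X)"
    using bounded_subset[OF compact_imp_bounded[OF compact_X] cut_map_image_subset[OF f]] .
  show "diameter (f ` X) \<le> b * D"
    using cut_map_dist_le[OF f] assms D_pos by (intro diameter_le) (auto simp: dist_norm)
qed

lemma card_cut_maps_ge_1:
  assumes "0 < b" "b < 1"
  shows "1 \<le> card (cut_maps N \<phi> r b)"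
proof -
  have "cut_maps N \<phi> r b \<noteq> {}"
    using attractor_subset_cut_maps[OF assms] attractor_nonempty[OF order_refl] by auto
  then show ?thesis
    using finite_cut_maps[OF assms(1)] by (simp add: Suc_le_eq card_gt_0_iff)
qed

lemma
  assumes "1 \<le> n" "word_from N n J" "S \<in> lmeasurable"
  shows lmeasurable_word_map_image: "W n J ` S \<in> lmeasurable"
    and measure_word_map_image: "measure lebesgue (W n J ` S) = ratio_from r n J ^ CARD('d) * measure lebesgue S"
proof -
  have "W n J ` S \<in> lmeasurable \<and> measure lebesgue (W n J ` S) = ratio_from r n J ^ CARD('d) * measure lebesgue S"
    using assms
  proof (induction J arbitrary: n)
    case (Cons j J)
    then have T: "W (Suc n) J ` S \<in> lmeasurable"
      "measure lebesgue (W (Suc n) J ` S) = ratio_from r (Suc n) J ^ CARD('d) * measure lebesgue S"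
      by auto
    have j: "1 \<le> n" "j \<in> {1..N n}"
      using Cons.prems by auto
    have "W n (j # J) ` S = (\<lambda>x. r n j *\<^sub>R (Om n j *v (x + \<alpha> n j))) ` W (Suc n) J ` S"
      using \<phi>_eq[OF j] by (simp add: image_comp)
    then show ?case
      using lmeasurable_similarity_image[OF orthogonal_Om[OF j] T(1), of "r n j" "\<alpha> n j"]
        measure_similarity_image[OF orthogonal_Om[OF j] T(1), of "r n j" "\<alpha> n j"] T(2) r_bounds[OF j]
      by (simp add: power_mult_distrib)
  qed simp
  then show "W n J ` S \<in> lmeasurable"
    "measure lebesgue (W n J ` S) = ratio_from r n J ^ CARD('d) * measure lebesgue S"
    by blast+
qed

end

section \<open>Counting cut maps\<close>

text \<open>The separation condition in numbers: \<open>u\<close> bounds all volumes of the sets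
  \<open>U n\<close> from below, and \<open>\<gamma>\<close> bounds how many distinct cut maps at
  one scale can have images meeting a given one.\<close>

locale MIFS_MWSC = MIFS X N \<phi> r Om \<alpha> a
  for X :: "(real ^ 'd) set" and N \<phi> r Om \<alpha> a +
  fixes U :: "nat \<Rightarrow> (real ^ 'd) set" and u :: real and \<gamma> :: nat
  assumes u_pos: "0 < u"
    and U: "\<And>n. 1 \<le> n \<Longrightarrow> U n \<in> lmeasurable \<and> U n \<subseteq> X \<and> u \<le> measure lebesgue (U n)"
    and multiplicity: "\<And>b I. 0 < b \<Longrightarrow> b < 1 \<Longrightarrow> I \<in> cut_words N r b \<Longrightarrow>
      card {word_map \<phi> 1 J | J. J \<in> cut_words N r b \<and>
        word_map \<phi> 1 J ` U (length J + 1) \<inter> word_map \<phi> 1 I ` U (length I + 1) \<noteq> {}} \<le> \<gamma>"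
begin

text \<open>Volume count: the sets \<open>f ` U\<close> for \<open>f\<close> in \<open>S\<close> lie in the ball, have volume at least
  \<open>(\<kappa> * b) ^ CARD('d) * u\<close> and cover no point more than \<open>\<gamma>\<close> times.\<close>

lemma card_cut_maps_in_cball:
  assumes b: "0 < b" "b < 1" and \<kappa>: "0 < \<kappa>" "\<And>J. J \<in> cut_words N r b \<Longrightarrow> \<kappa> * b \<le> ratio_from r 1 J"
    and S: "S \<subseteq> cut_maps N \<phi> r b" "\<And>f. f \<in> S \<Longrightarrow> f ` X \<subseteq> cball v \<rho>"
  shows "real (card S) * ((\<kappa> * b) ^ CARD('d) * u) \<le> real \<gamma> * measure lebesgue (cball v \<rho>)"
proof -
  have fin: "finite S"
    using S(1) finite_cut_maps[OF b(1)] finite_subset by blast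
  have "\<exists>J. J \<in> cut_words N r b \<and> f = W 1 J" if "f \<in> S" for f
    using that S(1) unfolding cut_maps_def by blast
  \<comment> \<open>The choice of a word matters because its length selects the set \<open>U\<close>
    attached to the map. Each map is then counted once, in agreement with
    \<open>multiplicity\<close>.\<close>
  then obtain w where w: "\<And>f. f \<in> S \<Longrightarrow> w f \<in> cut_words N r b \<and> f = W 1 (w f)"
    by metis
  define T where "T f = f ` U (length (w f) + 1)" for f
  have T: "T f \<in> lmeasurable" "(\<kappa> * b) ^ CARD('d) * u \<le> measure lebesgue (T f)" "T f \<subseteq> cball v \<rho>"
    if f: "f \<in> S" for f
  proof -
    let ?U = "U (length (w f) + 1)"
    have Uf: "?U \<in> lmeasurable" "?U \<subseteq> X" "u \<le> measure lebesgue ?U"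
      using U[of "length (w f) + 1"] by auto
    have wf: "word_from N 1 (w f)"
      using w[OF f] cut_words_iff by blast
    have Tf: "T f = W 1 (w f) ` ?U"
      using w[OF f] unfolding T_def by metis
    show "T f \<in> lmeasurable"
      unfolding Tf by (rule lmeasurable_word_map_image[OF order_refl wf Uf(1)])
    have "(\<kappa> * b) ^ CARD('d) * u \<le> ratio_from r 1 (w f) ^ CARD('d) * measure lebesgue ?U"
      using \<kappa>(2)[of "w f"] w[OF f] \<kappa>(1) b(1) Uf(3) u_pos ratio_from_pos[OF order_refl wf]
      by (intro mult_mono power_mono) auto
    then show "(\<kappa> * b) ^ CARD('d) * u \<le> measure lebesgue (T f)"
      unfolding Tf measure_word_map_image[OF order_refl wf Uf(1)] .
    show "T f \<subseteq> cball v \<rho>"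
      using S(2)[OF f] Uf(2) unfolding T_def by blast
  qed
  \<comment> \<open>If \<open>x\<close> lies in \<open>T f0\<close>, then every \<open>f\<close>
    with \<open>x\<close> in \<open>T f\<close> has an image meeting that of \<open>f0\<close>, so
    the bound at the single word \<open>w f0\<close> controls all of them.\<close>
  have mult: "(\<Sum>f\<in>S. indicat_real (T f) x) \<le> real \<gamma> * indicat_real (cball v \<rho>) x" for x
  proof (cases "\<exists>f\<in>S. x \<in> T f")
    case True
    then obtain f0 where f0: "f0 \<in> S" "x \<in> T f0"
      by blast
    let ?M = "{W 1 J | J. J \<in> cut_words N r b \<and>
        W 1 J ` U (length J + 1) \<inter> W 1 (w f0) ` U (length (w f0) + 1) \<noteq> {}}"
    have "{f\<in>S. x \<in> T f} \<subseteq> ?M"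
    proof
      fix f assume f: "f \<in> {f\<in>S. x \<in> T f}"
      then have "x \<in> W 1 (w f) ` U (length (w f) + 1)" "x \<in> W 1 (w f0) ` U (length (w f0) + 1)"
        using f0 w[of f] w[of f0] unfolding T_def by auto
      then show "f \<in> ?M"
        using w[of f] f by blast
    qed
    moreover have "finite ?M"
      by (rule finite_subset[OF _ finite_imageI[OF finite_cut_words[OF b(1)], of "W 1"]]) blast
    ultimately have "card {f\<in>S. x \<in> T f} \<le> card ?M"
      by (intro card_mono)
    also have "\<dots> \<le> \<gamma>"
      using w[OF f0(1)] by (intro multiplicity b) blast
    finally have "card {f\<in>S. x \<in> T f} \<le> \<gamma>" .
    moreover have "(\<Sum>f\<in>S. indicat_real (T f) x) = real (card {f\<in>S. x \<in> T f})"
      using fin by (simp add: indicator_def sum.If_cases Int_def)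
    moreover have "x \<in> cball v \<rho>"
      using T(3)[OF f0(1)] f0(2) by blast
    ultimately show ?thesis
      by simp
  next
    case False
    then have "(\<Sum>f\<in>S. indicat_real (T f) x) = 0"
      by (intro sum.neutral) auto
    then show ?thesis
      by simp
  qed
  have int: "integrable lebesgue (indicat_real (T f))" if "f \<in> S" for f
    using fmeasurableD[OF T(1)[OF that]] fmeasurableD2[OF T(1)[OF that]]
    by (intro integrable_real_indicator) (simp_all add: less_top)
  have int_cball: "integrable lebesgue (indicat_real (cball v \<rho>))"
    using fmeasurableD[OF lmeasurable_cball[of v \<rho>]] fmeasurableD2[OF lmeasurable_cball[of v \<rho>]]
    by (intro integrable_real_indicator) (simp_all add: less_top)
  have "real (card S) * ((\<kappa> * b) ^ CARD('d) * u) \<le> (\<Sum>f\<in>S. measure lebesgue (T f))"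
    using sum_mono[of S "\<lambda>_. (\<kappa> * b) ^ CARD('d) * u" "\<lambda>f. measure lebesgue (T f)"] T(2) by simp
  also have "\<dots> = (\<Sum>f\<in>S. \<integral>x. indicat_real (T f) x \<partial>lebesgue)"
    by simp
  also have "\<dots> = (\<integral>x. (\<Sum>f\<in>S. indicat_real (T f) x) \<partial>lebesgue)"
    using int by (subst Bochner_Integration.integral_sum) auto
  also have "\<dots> \<le> (\<integral>x. real \<gamma> * indicat_real (cball v \<rho>) x \<partial>lebesgue)"
    using int int_cball mult by (intro integral_mono) auto
  also have "\<dots> = real \<gamma> * measure lebesgue (cball v \<rho>)"
    by simp
  finally show ?thesis .
qed

text \<open>The common hypothesis behind both cases: cut words do not overshoot the scale by more
  than the factor \<open>\<kappa> b\<close>, and \<open>\<kappa> b\<close> decays slower than every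
  positive power of \<open>b\<close>.\<close>

definition admissible_ratio :: "(real \<Rightarrow> real) \<Rightarrow> bool" where
  "admissible_ratio \<kappa> \<longleftrightarrow> (\<forall>b. 0 < b \<longrightarrow> b < 1 \<longrightarrow>
     0 < \<kappa> b \<and> \<kappa> b \<le> 1 \<and> (\<forall>J\<in>cut_words N r b. \<kappa> b * b \<le> ratio_from r 1 J)) \<and>
     ((\<lambda>b. ln (\<kappa> b) / - ln b) \<longlongrightarrow> 0) (at_right 0)"

lemma measure_cball_eq: "0 \<le> \<rho> \<Longrightarrow> measure lborel (cball (v::real ^ 'd) \<rho>) = \<rho> ^ CARD('d) * unit_ball_vol (real CARD('d))"
  by (simp add: content_cball)

text \<open>\<open>Q\<close> must be independent of \<open>b\<close> and \<open>\<kappa>\<close>,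
  since \<open>\<kappa>\<close> will vary with \<open>b\<close>. The first bound is the local volume
  count, the second the cover by cylinders, and the third the volume count on all of
  \<open>X\<close>.\<close>

lemma cut_maps_bounds:
  obtains Q :: real where "1 \<le> Q"
    "\<And>b \<kappa>. 0 < b \<Longrightarrow> b < 1 \<Longrightarrow> 0 < \<kappa> \<Longrightarrow> \<kappa> \<le> 1 \<Longrightarrow> (\<And>J. J \<in> cut_words N r b \<Longrightarrow> \<kappa> * b \<le> ratio_from r 1 J) \<Longrightarrow>
      real (card (cut_maps N \<phi> r b)) \<le> Q * (1 / \<kappa>) ^ CARD('d) * real (covering_number (K 1) b) \<and>
      real (covering_number (K 1) b) \<le> Q * (1 / \<kappa>) ^ CARD('d) * real (card (cut_maps N \<phi> r b)) \<and>
      real (card (cut_maps N \<phi> r b)) \<le> Q * (1 / \<kappa>) ^ CARD('d) * (1 / b) ^ CARD('d)"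
proof -
  let ?d = "CARD('d)"
  define \<omega> where "\<omega> = unit_ball_vol (real ?d)"
  have \<omega>: "0 < \<omega>"
    unfolding \<omega>_def by (rule unit_ball_vol_pos) simp
  \<comment> \<open>What remains of the volume inequality for a ball of radius
    \<open>(1 + D) * t\<close> once the powers of \<open>\<kappa>\<close>, \<open>b\<close> and
    \<open>t\<close> are split off.\<close>
  define Q where "Q = real \<gamma> * \<omega> * (1 + D) ^ ?d / u"
  have "0 \<le> Q"
    unfolding Q_def using \<omega> D_pos u_pos by simp
  obtain C :: nat where C: "1 \<le> C" "\<And>(E::(real ^ 'd) set) \<delta>. bounded E \<Longrightarrow> 0 < \<delta> \<Longrightarrow>
    covering_number E \<delta> \<le> C * covering_number E (D * \<delta>)"
    using covering_number_doubling[OF D_pos] by blast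
  have main: "real (card (cut_maps N \<phi> r b)) \<le> (Q + C) * (1 / \<kappa>) ^ ?d * real (covering_number (K 1) b) \<and>
      real (covering_number (K 1) b) \<le> (Q + C) * (1 / \<kappa>) ^ ?d * real (card (cut_maps N \<phi> r b)) \<and>
      real (card (cut_maps N \<phi> r b)) \<le> (Q + C) * (1 / \<kappa>) ^ ?d * (1 / b) ^ ?d"
    if b: "0 < b" "b < 1" and \<kappa>: "0 < \<kappa>" "\<kappa> \<le> 1" and cut: "\<And>J. J \<in> cut_words N r b \<Longrightarrow> \<kappa> * b \<le> ratio_from r 1 J"
    for b \<kappa>
  proof (intro conjI)
    \<comment> \<open>The scale \<open>t\<close> is left free: \<open>t = b\<close> handles the maps
      near one covering set, \<open>t = 1\<close> all maps together.\<close>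
    have count: "real (card S) \<le> Q * (1 / \<kappa>) ^ ?d * (t / b) ^ ?d"
      if S: "S \<subseteq> cut_maps N \<phi> r b" "\<And>f. f \<in> S \<Longrightarrow> f ` X \<subseteq> cball v ((1 + D) * t)" and t: "0 \<le> t" for S v t
    proof -
      have "real (card S) * ((\<kappa> * b) ^ ?d * u) \<le> real \<gamma> * measure lebesgue (cball v ((1 + D) * t))"
        by (rule card_cut_maps_in_cball[OF b \<kappa>(1) cut S])
      also have "measure lebesgue (cball v ((1 + D) * t)) = ((1 + D) * t) ^ ?d * \<omega>"
        using measure_cball_eq[of "(1 + D) * t" v] t D_pos unfolding \<omega>_def by simp
      finally have "real (card S) \<le> real \<gamma> * (((1 + D) * t) ^ ?d * \<omega>) / ((\<kappa> * b) ^ ?d * u)"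
        using \<kappa>(1) b(1) u_pos by (simp add: pos_le_divide_eq)
      also have "\<dots> = Q * (1 / \<kappa>) ^ ?d * (t / b) ^ ?d"
        unfolding Q_def power_mult_distrib power_divide by (simp add: divide_simps)
      finally show ?thesis .
    qed
    obtain \<U> where \<U>: "finite \<U>" "card \<U> = covering_number (K 1) b"
      "\<And>V. V \<in> \<U> \<Longrightarrow> bounded V" "\<And>V. V \<in> \<U> \<Longrightarrow> diameter V \<le> b" "K 1 \<subseteq> \<Union>\<U>"
      using covering_number_witness[OF attractor_bounded[OF order_refl] b(1)] by metis
    \<comment> \<open>Each map is charged to the covering sets that its image of \<open>X\<close>
      meets. Such an image contains a point of \<open>K 1\<close>, so these families exhaust the cut
      maps; it also has diameter at most \<open>b * D\<close>, which explains the radius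
      \<open>(1 + D) * b\<close>.\<close>
    define A where "A V = {f \<in> cut_maps N \<phi> r b. f ` X \<inter> V \<noteq> {}}" for V
    have A: "real (card (A V)) \<le> Q * (1 / \<kappa>) ^ ?d" if V: "V \<in> \<U>" for V
    proof (cases "V = {}")
      case True
      then show ?thesis
        using \<open>0 \<le> Q\<close> \<kappa>(1) by (simp add: A_def)
    next
      case False
      then obtain v where v: "v \<in> V"
        by blast
      have "f ` X \<subseteq> cball v ((1 + D) * b)" if f: "f \<in> A V" for f
      proof (rule image_subsetI)
        fix x assume x: "x \<in> X"
        obtain y where y: "y \<in> X" "f y \<in> V" and fc: "f \<in> cut_maps N \<phi> r b"
          using f unfolding A_def by auto
        have "dist v (f x) \<le> dist v (f y) + dist (f y) (f x)"
          by (rule dist_triangle)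
        also have "dist v (f y) \<le> b"
          using diameter_bounded_bound[OF \<U>(3)[OF V] v y(2)] \<U>(4)[OF V] by linarith
        also have "dist (f y) (f x) \<le> b * D"
          by (rule cut_map_dist_le[OF fc y(1) x])
        finally show "f x \<in> cball v ((1 + D) * b)"
          by (simp add: algebra_simps)
      qed
      then have "real (card (A V)) \<le> Q * (1 / \<kappa>) ^ ?d * (b / b) ^ ?d"
        using b(1) by (intro count[of _ v]) (auto simp: A_def)
      then show ?thesis
        using b(1) by simp
    qed
    have "cut_maps N \<phi> r b \<subseteq> (\<Union>V\<in>\<U>. A V)"
    proof
      fix f assume f: "f \<in> cut_maps N \<phi> r b"
      then obtain J where J: "f = W 1 J" "word_from N 1 J"
        unfolding cut_maps_def image_iff Bex_def cut_words_iff by metis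
      have "1 \<le> 1 + length J"
        by simp
      then obtain y where y: "y \<in> K (1 + length J)" "y \<in> X"
        using attractor_nonempty attractor_subset by blast
      have "f y \<in> K 1"
        using word_map_attractor[OF order_refl J(2) y(1)] J(1) by simp
      then obtain V where "V \<in> \<U>" "f y \<in> V"
        using \<U>(5) by blast
      then show "f \<in> (\<Union>V\<in>\<U>. A V)"
        using f y(2) unfolding A_def by blast
    qed
    then have "card (cut_maps N \<phi> r b) \<le> card (\<Union>V\<in>\<U>. A V)"
      using \<U>(1) finite_cut_maps[OF b(1)] by (intro card_mono finite_UN_I) (auto simp: A_def)
    also have "\<dots> \<le> (\<Sum>V\<in>\<U>. card (A V))"
      by (rule card_UN_le[OF \<U>(1)])
    finally have "real (card (cut_maps N \<phi> r b)) \<le> (\<Sum>V\<in>\<U>. real (card (A V)))"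
      by (simp flip: of_nat_sum)
    also have "\<dots> \<le> real (card \<U>) * (Q * (1 / \<kappa>) ^ ?d)"
      using sum_mono[of \<U> "\<lambda>V. real (card (A V))" "\<lambda>_. Q * (1 / \<kappa>) ^ ?d"] A by simp
    also have "\<dots> \<le> (Q + C) * (1 / \<kappa>) ^ ?d * real (covering_number (K 1) b)"
      using \<kappa>(1) \<open>0 \<le> Q\<close> unfolding \<U>(2) by (simp add: algebra_simps)
    finally show "real (card (cut_maps N \<phi> r b)) \<le> (Q + C) * (1 / \<kappa>) ^ ?d * real (covering_number (K 1) b)" .
    have "covering_number (K 1) b \<le> C * covering_number (K 1) (D * b)"
      using C(2)[OF attractor_bounded[OF order_refl] b(1)] .
    also have "\<dots> \<le> C * card (cut_maps N \<phi> r b)"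
      using covering_number_le_card_cut_maps[OF b] by (intro mult_le_mono2) (simp add: mult.commute)
    finally have "real (covering_number (K 1) b) \<le> C * real (card (cut_maps N \<phi> r b))"
      by (simp flip: of_nat_mult)
    also have "C \<le> (Q + C) * (1 / \<kappa>) ^ ?d"
      using mult_mono[of "real C" "Q + C" 1 "(1 / \<kappa>) ^ ?d"] \<open>0 \<le> Q\<close> \<kappa> by (simp add: one_le_power)
    finally show "real (covering_number (K 1) b) \<le> (Q + C) * (1 / \<kappa>) ^ ?d * real (card (cut_maps N \<phi> r b))"
      by (simp add: mult_right_mono)
    have "f ` X \<subseteq> cball a ((1 + D) * 1)" if "f \<in> cut_maps N \<phi> r b" for f
    proof (rule image_subsetI)
      fix x assume "x \<in> X"
      then have "f x \<in> X"
        using cut_map_image_subset[OF that] by blast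
      then show "f x \<in> cball a ((1 + D) * 1)"
        using dist_le_D[OF a_in_X, of "f x"] by simp
    qed
    then have "real (card (cut_maps N \<phi> r b)) \<le> Q * (1 / \<kappa>) ^ ?d * (1 / b) ^ ?d"
      by (intro count[of _ a]) auto
    also have "\<dots> \<le> (Q + C) * (1 / \<kappa>) ^ ?d * (1 / b) ^ ?d"
      using \<kappa>(1) b(1) by (intro mult_right_mono) auto
    finally show "real (card (cut_maps N \<phi> r b)) \<le> (Q + C) * (1 / \<kappa>) ^ ?d * (1 / b) ^ ?d" .
  qed
  have "1 \<le> Q + C"
    using \<open>0 \<le> Q\<close> C(1) by linarith
  then show ?thesis
    using main by (rule that)
qed

lemma ln_power_ratio_tendsto_0:
  assumes "admissible_ratio \<kappa>" "0 < Q"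
  shows "((\<lambda>b. ln (Q * (1 / \<kappa> b) ^ m) / - ln b) \<longlongrightarrow> 0) (at_right 0)"
proof -
  have "((\<lambda>b. ln Q / - ln b - real m * (ln (\<kappa> b) / - ln b)) \<longlongrightarrow> 0 - real m * 0) (at_right 0)"
    using assms(1) unfolding admissible_ratio_def
    by (intro tendsto_diff tendsto_mult tendsto_const tendsto_const_over_neg_ln) blast
  moreover have "\<forall>\<^sub>F b in at_right 0. ln Q / - ln b - real m * (ln (\<kappa> b) / - ln b) = ln (Q * (1 / \<kappa> b) ^ m) / - ln b"
    using eventually_at_right_0_less[OF zero_less_one]
  proof eventually_elim
    case (elim b)
    then have \<kappa>: "0 < \<kappa> b"
      using assms(1) unfolding admissible_ratio_def by blast
    then have "ln (Q * (1 / \<kappa> b) ^ m) = ln Q - real m * ln (\<kappa> b)"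
      using assms(2) by (simp add: ln_mult_pos ln_realpow ln_div)
    then show ?case
      by (simp add: diff_divide_distrib)
  qed
  ultimately show ?thesis
    by (simp add: tendsto_cong)
qed

text \<open>In the third conclusion \<open>CARD('d)\<close> is the exponent of the crude bound, and
  the extra 1 absorbs \<open>ln (A b) / - ln b\<close>, which is eventually below 1.\<close>

lemma
  assumes "admissible_ratio \<kappa>"
  shows lower_box_dim_eq_cut_maps: "lower_box_dim (K 1) =
      Liminf (at_right 0) (\<lambda>b. ereal (ln (real (card (cut_maps N \<phi> r b))) / - ln b))"
    and upper_box_dim_eq_cut_maps: "upper_box_dim (K 1) =
      Limsup (at_right 0) (\<lambda>b. ereal (ln (real (card (cut_maps N \<phi> r b))) / - ln b))"
    and cut_maps_log_ratio_bounded: "\<forall>\<^sub>F b in at_right 0.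
      \<bar>ln (real (card (cut_maps N \<phi> r b))) / - ln b\<bar> \<le> real CARD('d) + 1"
proof -
  let ?d = "CARD('d)"
  obtain Q :: real where Q: "1 \<le> Q"
    "\<And>b \<kappa>. 0 < b \<Longrightarrow> b < 1 \<Longrightarrow> 0 < \<kappa> \<Longrightarrow> \<kappa> \<le> 1 \<Longrightarrow> (\<And>J. J \<in> cut_words N r b \<Longrightarrow> \<kappa> * b \<le> ratio_from r 1 J) \<Longrightarrow>
      real (card (cut_maps N \<phi> r b)) \<le> Q * (1 / \<kappa>) ^ ?d * real (covering_number (K 1) b) \<and>
      real (covering_number (K 1) b) \<le> Q * (1 / \<kappa>) ^ ?d * real (card (cut_maps N \<phi> r b)) \<and>
      real (card (cut_maps N \<phi> r b)) \<le> Q * (1 / \<kappa>) ^ ?d * (1 / b) ^ ?d"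
    using cut_maps_bounds by metis
  define A where "A b = Q * (1 / \<kappa> b) ^ ?d" for b
  have A: "((\<lambda>b. ln (A b) / - ln b) \<longlongrightarrow> 0) (at_right 0)"
    unfolding A_def using Q(1) by (intro ln_power_ratio_tendsto_0 assms) simp
  have bounds: "0 < A b \<and> real (card (cut_maps N \<phi> r b)) \<le> A b * real (covering_number (K 1) b) \<and>
      real (covering_number (K 1) b) \<le> A b * real (card (cut_maps N \<phi> r b)) \<and>
      real (card (cut_maps N \<phi> r b)) \<le> A b * (1 / b) ^ ?d" if b: "0 < b" "b < 1" for b
  proof -
    have \<kappa>: "0 < \<kappa> b" "\<kappa> b \<le> 1" "\<And>J. J \<in> cut_words N r b \<Longrightarrow> \<kappa> b * b \<le> ratio_from r 1 J"
      using assms b unfolding admissible_ratio_def by blast+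
    have "0 < A b"
      unfolding A_def using Q(1) \<kappa>(1) by simp
    then show ?thesis
      using Q(2)[OF b \<kappa>] unfolding A_def by blast
  qed
  have ev: "\<forall>\<^sub>F b in at_right 0. 1 \<le> real (covering_number (K 1) b) \<and> 1 \<le> real (card (cut_maps N \<phi> r b)) \<and>
      real (covering_number (K 1) b) \<le> A b * real (card (cut_maps N \<phi> r b)) \<and>
      real (card (cut_maps N \<phi> r b)) \<le> A b * real (covering_number (K 1) b)"
    using eventually_at_right_0_less[OF zero_less_one]
  proof eventually_elim
    case (elim b)
    then have b: "0 < b" "b < 1"
      by auto
    have "1 \<le> covering_number (K 1) b" "1 \<le> card (cut_maps N \<phi> r b)"
      using covering_number_ge_1[OF attractor_bounded[OF order_refl] b(1) attractor_nonempty[OF order_refl]]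
        card_cut_maps_ge_1[OF b] .
    then show ?case
      using bounds[OF b] by simp
  qed
  show "lower_box_dim (K 1) = Liminf (at_right 0) (\<lambda>b. ereal (ln (real (card (cut_maps N \<phi> r b))) / - ln b))"
    unfolding lower_box_dim_def by (rule Liminf_log_ratio_eq[OF ev A])
  show "upper_box_dim (K 1) = Limsup (at_right 0) (\<lambda>b. ereal (ln (real (card (cut_maps N \<phi> r b))) / - ln b))"
    unfolding upper_box_dim_def by (rule Limsup_log_ratio_eq[OF ev A])
  have "\<forall>\<^sub>F b in at_right 0. ln (A b) / - ln b < 1"
    using A by (rule order_tendstoD) simp
  then show "\<forall>\<^sub>F b in at_right 0. \<bar>ln (real (card (cut_maps N \<phi> r b))) / - ln b\<bar> \<le> real ?d + 1"
    using eventually_at_right_0_less[OF zero_less_one]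
  proof eventually_elim
    case (elim b)
    then have b: "0 < b" "b < 1"
      by auto
    let ?n = "real (card (cut_maps N \<phi> r b))"
    have n: "1 \<le> ?n"
      using card_cut_maps_ge_1[OF b] by simp
    have "ln ?n \<le> ln (A b * (1 / b) ^ ?d)"
      using bounds[OF b] n by simp
    also have "\<dots> = ln (A b) + real ?d * - ln b"
      using bounds[OF b] b by (simp add: ln_mult_pos ln_realpow ln_div)
    finally have "ln ?n / - ln b \<le> (ln (A b) + real ?d * - ln b) / - ln b"
      using b by (intro divide_right_mono) auto
    also have "\<dots> = ln (A b) / - ln b + real ?d"
      using b by (simp add: field_simps)
    finally have "ln ?n / - ln b \<le> real ?d + 1"
      using elim by linarith
    moreover have "0 \<le> ln ?n / - ln b"
      using n b by (intro divide_nonneg_pos) auto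
    ultimately show ?case
      by linarith
  qed
qed

text \<open>Without its last letter a cut word has ratio above \<open>b\<close>, and that letter
  costs at most a factor \<open>r0\<close>.\<close>

lemma admissible_ratio_const:
  assumes "0 < r0" "\<And>n j. 1 \<le> n \<Longrightarrow> j \<in> {1..N n} \<Longrightarrow> r0 \<le> r n j"
  shows "admissible_ratio (\<lambda>_. r0)"
proof -
  have "r0 \<le> 1"
    using assms(2)[of 1 1] r_bounds[of 1 1] N_ge_2[of 1] by simp
  moreover have "r0 * b \<le> ratio_from r 1 J" if b: "0 < b" and J: "J \<in> cut_words N r b" for b J
  proof -
    have J': "word_from N 1 J" "J \<noteq> []" "b < ratio_from r 1 (butlast J)"
      using J unfolding cut_words_iff by auto
    then obtain I j where I: "J = I @ [j]"
      by (metis append_butlast_last_id)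
    then have "word_from N 1 I" "j \<in> {1..N (1 + length I)}"
      using J'(1) by (simp_all add: word_from_append)
    then have "r0 * b \<le> r (1 + length I) j * ratio_from r 1 I"
      using assms b J'(3) r_bounds[of "1 + length I" j] unfolding I by (intro mult_mono) auto
    then show ?thesis
      by (simp add: I ratio_from_append mult.commute)
  qed
  ultimately show ?thesis
    unfolding admissible_ratio_def using assms(1) tendsto_const_over_neg_ln by blast
qed

end

section \<open>Equal ratios on each level and the passage to a sequence of scales\<close>

locale MIFS_homogeneous = MIFS_MWSC X N \<phi> r Om \<alpha> a U u \<gamma>
  for X :: "(real ^ 'd) set" and N \<phi> r Om \<alpha> a U u \<gamma> +
  fixes \<rho> :: "nat \<Rightarrow> real"
  assumes r_eq: "\<And>n j. 1 \<le> n \<Longrightarrow> j \<in> {1..N n} \<Longrightarrow> r n j = \<rho> n"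
    and lim: "(\<lambda>n. ln (\<rho> n) / ln (\<Prod>i=1..<n. \<rho> i)) \<longlonglongrightarrow> 0"
begin

definition P :: "nat \<Rightarrow> real" where "P m = (\<Prod>i=1..m. \<rho> i)"

lemma \<rho>_bounds: "1 \<le> n \<Longrightarrow> 0 < \<rho> n \<and> \<rho> n < 1"
  using r_eq[of n 1] r_bounds[of n 1] N_ge_2[of n] by simp

lemma P_0 [simp]: "P 0 = 1"
  by (simp add: P_def)

lemma P_Suc: "P (Suc m) = P m * \<rho> (Suc m)"
  by (simp add: P_def)

lemma P_pos: "0 < P m"
  unfolding P_def by (intro prod_pos) (use \<rho>_bounds in auto)

lemma P_Suc_less: "P (Suc m) < P m"
  using P_pos[of m] \<rho>_bounds[of "Suc m"] unfolding P_Suc by simp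

lemma P_less: "m < m' \<Longrightarrow> P m' < P m"
  using lift_Suc_mono_less[of "\<lambda>m. - P m" m m'] P_Suc_less by simp

lemma ratio_from_eq_P: "word_from N 1 J \<Longrightarrow> ratio_from r 1 J = P (length J)"
  by (simp add: P_def prod.atLeast1_atMost_eq ratio_from_eq_prod word_from_iff_nth r_eq)

text \<open>Constant words of letter 1 exist in every length, and their ratios are exactly the
  values of \<open>P\<close>.\<close>

lemma P_tendsto_0: "P \<longlonglongrightarrow> 0"
proof (rule LIMSEQ_I)
  fix e :: real assume "0 < e"
  then obtain k0 where k0: "\<And>J. word_from N 1 J \<Longrightarrow> k0 \<le> length J \<Longrightarrow> ratio_from r 1 J < e"
    using ratio_from_small[OF order_refl] by blast
  have "address N 1 (\<lambda>_. 1)"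
    unfolding address_def using N_ge_2 by (metis atLeastAtMost_iff le_trans one_le_numeral order_refl)
  note word = word_from_prefix[OF this]
  have "P m < e" if "k0 \<le> m" for m
    using k0[OF word, of m] ratio_from_eq_P[OF word, of m] that by simp
  then show "\<exists>no. \<forall>n\<ge>no. norm (P n - 0) < e"
    using P_pos by (intro exI[of _ k0]) (simp add: abs_of_pos)
qed

text \<open>Ratios depend only on length, so for \<open>b\<close> between 0 and 1 this is the common
  length of all cut words, and \<open>P (level b)\<close> is their common ratio.\<close>

definition level :: "real \<Rightarrow> nat" where "level b = (LEAST m. P m \<le> b)"

lemma P_level: "0 < b \<Longrightarrow> P (level b) \<le> b"
proof -
  assume "0 < b"
  then have "\<forall>\<^sub>F m in sequentially. P m < b"
    by (rule order_tendstoD(2)[OF P_tendsto_0])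
  then obtain m where "P m \<le> b"
    unfolding eventually_sequentially by (meson less_imp_le order_refl)
  then show ?thesis
    unfolding level_def by (rule LeastI)
qed

lemma less_P_of_less_level: "m < level b \<Longrightarrow> b < P m"
  unfolding level_def using not_less_Least[of m "\<lambda>m. P m \<le> b"] by (simp add: not_le)

lemma level_P: "level (P m) = m"
  unfolding level_def
proof (rule Least_equality)
  show "m \<le> m'" if "P m' \<le> P m" for m'
    using P_less[of m' m] that by linarith
qed simp

lemma level_pos: "0 < b \<Longrightarrow> b < 1 \<Longrightarrow> 0 < level b"
  using P_level[of b] by (cases "level b") auto

lemma cut_words_level:
  assumes "0 < b" "b < 1"
  shows "cut_words N r b = {J. word_from N 1 J \<and> length J = level b}"
proof -
  have "J \<noteq> [] \<and> ratio_from r 1 J \<le> b \<and> b < ratio_from r 1 (butlast J) \<longleftrightarrow> length J = level b"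
    if J: "word_from N 1 J" for J
  proof (cases "J = []")
    case False
    then have "word_from N 1 (butlast J)"
      using J word_from_append[of N 1 "butlast J" "[last J]"] by simp
    from ratio_from_eq_P[OF this] have "ratio_from r 1 (butlast J) = P (length J - 1)"
      by simp
    moreover have "P (length J) \<le> b \<and> b < P (length J - 1) \<longleftrightarrow> length J = level b"
    proof
      assume *: "P (length J) \<le> b \<and> b < P (length J - 1)"
      then have "\<not> length J < level b"
        using less_P_of_less_level[of "length J" b] by linarith
      moreover have "\<not> level b < length J"
      proof
        assume "level b < length J"
        then have "level b = length J - 1 \<or> level b < length J - 1"
          by linarith
        then have "P (length J - 1) \<le> P (level b)"
          using P_less less_imp_le by auto
        then show False
          using * P_level[OF assms(1)] by linarith
      qed
      ultimately show "length J = level b"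
        by linarith
    next
      assume "length J = level b"
      then show "P (length J) \<le> b \<and> b < P (length J - 1)"
        using P_level[OF assms(1)] less_P_of_less_level[of "length J - 1" b] level_pos[OF assms] by simp
    qed
    ultimately show ?thesis
      using False ratio_from_eq_P[OF J] by simp
  qed (use level_pos[OF assms] in simp)
  then show ?thesis
    by (intro set_eqI) (simp only: cut_words_iff mem_Collect_eq, blast)
qed

lemma cut_maps_level:
  assumes "0 < b" "b < 1"
  shows "cut_maps N \<phi> r (P (level b)) = cut_maps N \<phi> r b"
  unfolding cut_maps_def cut_words_level[OF assms]
    cut_words_level[OF P_pos le_less_trans[OF P_level[OF assms(1)] assms(2)]] level_P ..

lemma filterlim_level: "filterlim level at_top (at_right 0)"
  unfolding filterlim_at_top
proof
  fix M
  show "\<forall>\<^sub>F b in at_right 0. M \<le> level b"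
    using eventually_at_right_0_less[OF P_pos[of M]]
  proof eventually_elim
    case (elim b)
    show ?case
    proof (rule ccontr)
      assume "\<not> M \<le> level b"
      then have "P M < P (level b)"
        by (intro P_less) simp
      then show False
        using P_level[of b] elim by linarith
    qed
  qed
qed

lemma filtermap_level: "filtermap level (at_right 0) = sequentially"
proof (rule antisym)
  show "filtermap level (at_right 0) \<le> sequentially"
    using filterlim_level unfolding filterlim_def .
  show "sequentially \<le> filtermap level (at_right 0)"
  proof (rule filter_leI)
    fix Q assume "eventually Q (filtermap level (at_right 0))"
    then obtain e where e: "0 < e" "\<And>b. 0 < b \<Longrightarrow> b < e \<Longrightarrow> Q (level b)"
      unfolding eventually_filtermap eventually_at_right_field by auto
    have "\<forall>\<^sub>F m in sequentially. P m < e"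
      by (rule order_tendstoD(2)[OF P_tendsto_0 e(1)])
    then show "\<forall>\<^sub>F m in sequentially. Q m"
    proof eventually_elim
      case (elim m)
      show ?case
        using e(2)[OF P_pos elim] unfolding level_P .
    qed
  qed
qed

lemma ln_level_ratio_tendsto_0: "((\<lambda>b. ln (P (level b) / b) / - ln b) \<longlongrightarrow> 0) (at_right 0)"
proof -
  let ?h = "\<lambda>n. ln (\<rho> n) / ln (\<Prod>i=1..<n. \<rho> i)"
  have "((\<lambda>b. ?h (level b)) \<longlongrightarrow> 0) (at_right 0)"
    using filterlim_compose[OF lim filterlim_level] .
  moreover have "\<forall>\<^sub>F b in at_right 0. 2 \<le> level b"
    using filterlim_level unfolding filterlim_at_top by blast
  then have "\<forall>\<^sub>F b in at_right 0. norm (ln (P (level b) / b) / - ln b) \<le> ?h (level b)"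
    using eventually_at_right_0_less[OF zero_less_one]
  proof eventually_elim
    case (elim b)
    then have b: "0 < b" "b < 1"
      by auto
    obtain m where m: "level b = Suc m" "1 \<le> m"
      using elim by (cases "level b") auto
    have "{1..<Suc m} = {1..m}"
      by auto
    then have h: "?h (level b) = ln (\<rho> (Suc m)) / ln (P m)"
      unfolding m(1) P_def by simp
    have bP: "b < P m"
      using less_P_of_less_level[of m b] m(1) by simp
    have "P m < 1"
      using P_less[of 0 m] m(2) by simp
    have "P (level b) = P m * \<rho> (Suc m)"
      unfolding m(1) by (rule P_Suc)
    then have "\<rho> (Suc m) \<le> P (level b) / b"
      using bP b(1) \<rho>_bounds[of "Suc m"] by (simp add: pos_le_divide_eq mult.commute[of "P m"])
    then have "ln (\<rho> (Suc m)) \<le> ln (P (level b) / b)"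
      using \<rho>_bounds[of "Suc m"] P_pos[of "level b"] b(1) by simp
    moreover have "ln (P (level b) / b) \<le> 0"
      using P_level[OF b(1)] P_pos[of "level b"] b(1) by simp
    ultimately have "\<bar>ln (P (level b) / b)\<bar> \<le> - ln (\<rho> (Suc m))"
      by linarith
    moreover have "0 < - ln (P m)" "- ln (P m) \<le> - ln b"
      using \<open>P m < 1\<close> P_pos[of m] bP b by simp_all
    ultimately have "\<bar>ln (P (level b) / b)\<bar> / - ln b \<le> - ln (\<rho> (Suc m)) / - ln (P m)"
      by (intro frac_le) auto
    then show ?case
      using b unfolding h by (simp add: abs_divide)
  qed
  ultimately show ?thesis
    by (rule Lim_null_comparison[rotated])
qed

lemma admissible_ratio_level: "admissible_ratio (\<lambda>b. P (level b) / b)"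
  unfolding admissible_ratio_def
proof (intro conjI allI impI ballI)
  fix b :: real and J assume b: "0 < b" "b < 1"
  show "0 < P (level b) / b" "P (level b) / b \<le> 1"
    using P_pos[of "level b"] P_level[OF b(1)] b(1) by simp_all
  assume "J \<in> cut_words N r b"
  then show "P (level b) / b * b \<le> ratio_from r 1 J"
    using b(1) ratio_from_eq_P[of J] unfolding cut_words_level[OF b] by simp
qed (rule ln_level_ratio_tendsto_0)

lemma
  shows Liminf_cut_maps_eq_liminf:
    "Liminf (at_right 0) (\<lambda>b. ereal (ln (real (card (cut_maps N \<phi> r b))) / - ln b)) =
      liminf (\<lambda>m. ereal (ln (real (card (cut_maps N \<phi> r (P m)))) / - ln (P m)))"
    and Limsup_cut_maps_eq_limsup:
    "Limsup (at_right 0) (\<lambda>b. ereal (ln (real (card (cut_maps N \<phi> r b))) / - ln b)) =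
      limsup (\<lambda>m. ereal (ln (real (card (cut_maps N \<phi> r (P m)))) / - ln (P m)))"
proof -
  define g where "g b = ln (real (card (cut_maps N \<phi> r b))) / - ln b" for b
  let ?M = "real CARD('d) + 1"
  have "((\<lambda>b. ?M * norm (ln (P (level b) / b) / - ln b)) \<longlongrightarrow> ?M * norm (0::real)) (at_right 0)"
    by (intro tendsto_mult tendsto_const tendsto_norm ln_level_ratio_tendsto_0)
  then have bound: "((\<lambda>b. ?M * norm (ln (P (level b) / b) / - ln b)) \<longlongrightarrow> 0) (at_right 0)"
    by simp
  have "\<forall>\<^sub>F b in at_right 0. norm (g b - g (P (level b))) \<le> ?M * norm (ln (P (level b) / b) / - ln b)"
    using cut_maps_log_ratio_bounded[OF admissible_ratio_level] eventually_at_right_0_less[OF zero_less_one]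
  proof eventually_elim
    case (elim b)
    then have b: "0 < b" "b < 1"
      by auto
    let ?p = "P (level b)"
    have p: "0 < ?p" "?p \<le> b"
      using P_pos P_level[OF b(1)] by auto
    have lnb: "ln b < 0" "ln ?p \<le> ln b"
      using p b by simp_all
    have "g b - g ?p = g b * ((ln ?p - ln b) / ln ?p)"
      using lnb unfolding g_def cut_maps_level[OF b] by (simp add: field_simps)
    then have "norm (g b - g ?p) = \<bar>g b\<bar> * (\<bar>ln (?p / b)\<bar> / \<bar>ln ?p\<bar>)"
      using p(1) b(1) by (simp add: abs_mult abs_divide ln_div)
    also have "\<dots> \<le> ?M * (\<bar>ln (?p / b)\<bar> / \<bar>ln b\<bar>)"
      using elim lnb unfolding g_def by (intro mult_mono frac_le) auto
    finally show ?case
      by (simp add: abs_divide)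
  qed
  then have diff: "((\<lambda>b. g b - g (P (level b))) \<longlongrightarrow> 0) (at_right 0)"
    by (rule Lim_null_comparison[OF _ bound])
  show "Liminf (at_right 0) (\<lambda>b. ereal (ln (real (card (cut_maps N \<phi> r b))) / - ln b)) =
      liminf (\<lambda>m. ereal (ln (real (card (cut_maps N \<phi> r (P m)))) / - ln (P m)))"
    using Liminf_eq_of_diff_tendsto_0[OF diff] Liminf_compose_filtermap[of "at_right 0" "\<lambda>m. ereal (g (P m))" level]
    unfolding filtermap_level g_def by simp
  show "Limsup (at_right 0) (\<lambda>b. ereal (ln (real (card (cut_maps N \<phi> r b))) / - ln b)) =
      limsup (\<lambda>m. ereal (ln (real (card (cut_maps N \<phi> r (P m)))) / - ln (P m)))"
    using Limsup_eq_of_diff_tendsto_0[OF diff] Limsup_compose_filtermap[of "at_right 0" "\<lambda>m. ereal (g (P m))" level]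
    unfolding filtermap_level g_def by simp
qed

end

lemma MIFS_MWSC_obtain:
  fixes X :: "(real ^ 'd) set"
  assumes "self_similar_MIFS X N \<phi> r Om \<alpha>" "MWSC X N \<phi> r" "a \<in> X"
  obtains U u \<gamma> where "MIFS_MWSC X N \<phi> r Om \<alpha> a U u \<gamma>"
proof -
  interpret MIFS X N \<phi> r Om \<alpha> a
    using assms by unfold_locales
  let ?card = "\<lambda>U b I. card {word_map \<phi> 1 J | J. J \<in> cut_words N r b \<and>
    word_map \<phi> 1 J ` U (length J + 1) \<inter> word_map \<phi> 1 I ` U (length I + 1) \<noteq> {}}"
  obtain U where U_all: "\<forall>n\<ge>1. U n \<in> sets lebesgue \<and> U n \<subseteq> X"
    and pos: "0 < (INF n\<in>{1..}. emeasure lebesgue (U n))"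
    and fin: "(SUP b\<in>{0<..<1}. SUP I\<in>cut_words N r b. enat (?card U b I)) < \<infinity>"
    using assms(2) unfolding MWSC_def by (elim exE conjE) (rule that)
  note U = U_all[rule_format]
  have meas: "U n \<in> lmeasurable" if "1 \<le> n" for n
    using U[OF that] bounded_subset[OF compact_imp_bounded[OF compact_X]]
    by (intro bounded_set_imp_lmeasurable) auto
  define v where "v = (INF n\<in>{1..}. emeasure lebesgue (U n))"
  have "v \<le> emeasure lebesgue (U 1)"
    unfolding v_def by (rule INF_lower) simp
  also have "\<dots> < \<infinity>"
    using fmeasurableD2[OF meas[OF order_refl]] by (simp add: less_top)
  finally obtain u where u: "0 \<le> u" "v = ennreal u"
    by (cases v) auto
  have "0 < u"
    using pos unfolding v_def[symmetric] u(2) by simp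
  have u_le: "u \<le> measure lebesgue (U n)" if "1 \<le> n" for n
  proof -
    have "ennreal u \<le> emeasure lebesgue (U n)"
      unfolding u(2)[symmetric] v_def using that by (intro INF_lower) simp
    also have "\<dots> = ennreal (measure lebesgue (U n))"
      using fmeasurableD2[OF meas[OF that]] by (simp add: emeasure_eq_ennreal_measure)
    finally show ?thesis
      by (simp add: ennreal_le_iff)
  qed
  obtain \<gamma> where \<gamma>: "(SUP b\<in>{0<..<1}. SUP I\<in>cut_words N r b. enat (?card U b I)) = enat \<gamma>"
    using less_infinityE[OF fin] .
  have mult: "?card U b I \<le> \<gamma>" if "0 < b" "b < 1" "I \<in> cut_words N r b" for b I
  proof -
    have "enat (?card U b I) \<le> (SUP I\<in>cut_words N r b. enat (?card U b I))"
      using that(3) by (rule SUP_upper)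
    also have "\<dots> \<le> enat \<gamma>"
      unfolding \<gamma>[symmetric] using that by (intro SUP_upper) simp
    finally show ?thesis
      by simp
  qed
  have "MIFS_MWSC X N \<phi> r Om \<alpha> a U u \<gamma>"
  proof (rule MIFS_MWSC.intro[OF MIFS_axioms], rule MIFS_MWSC_axioms.intro)
    show "U n \<in> lmeasurable \<and> U n \<subseteq> X \<and> u \<le> measure lebesgue (U n)" if "1 \<le> n" for n
      using meas[OF that] U[OF that] u_le[OF that] by simp
  qed (fact \<open>0 < u\<close>, rule mult)
  then show ?thesis
    by (rule that)
qed

theorem theorem4p1:
  fixes X :: "(real ^ 'd) set"
    and N :: "nat \<Rightarrow> nat"
    and \<phi> :: "nat \<Rightarrow> nat \<Rightarrow> real ^ 'd \<Rightarrow> real ^ 'd"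
    and r :: "nat \<Rightarrow> nat \<Rightarrow> real"
    and Om :: "nat \<Rightarrow> nat \<Rightarrow> real ^ 'd ^ 'd"
    and \<alpha> :: "nat \<Rightarrow> nat \<Rightarrow> real ^ 'd"
    and a :: "real ^ 'd"
  assumes "self_similar_MIFS X N \<phi> r Om \<alpha>"
    and "MWSC X N \<phi> r"
    and "a \<in> X"
  shows
    "(0 < Inf {r n j | n j. 1 \<le> n \<and> 1 \<le> j \<and> j \<le> N n} \<longrightarrow>
       (\<forall>n\<ge>1.
          lower_box_dim (attractor N \<phi> a n) =
            Liminf (at_right 0) (\<lambda>b. ereal (ln (real (card (cut_maps N \<phi> r b))) / - ln b)) \<and>
          Liminf (at_right 0) (\<lambda>b. ereal (ln (real (card (cut_maps N \<phi> r b))) / - ln b)) \<le>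
            Limsup (at_right 0) (\<lambda>b. ereal (ln (real (card (cut_maps N \<phi> r b))) / - ln b)) \<and>
          Limsup (at_right 0) (\<lambda>b. ereal (ln (real (card (cut_maps N \<phi> r b))) / - ln b)) =
            upper_box_dim (attractor N \<phi> a n) \<and>
          upper_box_dim (attractor N \<phi> a n) = packing_dim (attractor N \<phi> a n)))
     \<and>
     (\<forall>\<rho> :: nat \<Rightarrow> real.
       (\<forall>n\<ge>1. \<forall>j\<in>{1..N n}. r n j = \<rho> n) \<and>
       (\<lambda>n. ln (\<rho> n) / ln (\<Prod>i=1..<n. \<rho> i)) \<longlonglongrightarrow> 0 \<longrightarrow>
       (\<forall>n\<ge>1.
          lower_box_dim (attractor N \<phi> a n) =
            Liminf (at_right 0) (\<lambda>b. ereal (ln (real (card (cut_maps N \<phi> r b))) / - ln b)) \<and>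
          Liminf (at_right 0) (\<lambda>b. ereal (ln (real (card (cut_maps N \<phi> r b))) / - ln b)) =
            liminf (\<lambda>m. ereal (ln (real (card (cut_maps N \<phi> r (\<Prod>i=1..m. \<rho> i))))
                                 / - ln (\<Prod>i=1..m. \<rho> i))) \<and>
          upper_box_dim (attractor N \<phi> a n) = packing_dim (attractor N \<phi> a n) \<and>
          packing_dim (attractor N \<phi> a n) =
            Limsup (at_right 0) (\<lambda>b. ereal (ln (real (card (cut_maps N \<phi> r b))) / - ln b)) \<and>
          Limsup (at_right 0) (\<lambda>b. ereal (ln (real (card (cut_maps N \<phi> r b))) / - ln b)) =
            limsup (\<lambda>m. ereal (ln (real (card (cut_maps N \<phi> r (\<Prod>i=1..m. \<rho> i))))
                                 / - ln (\<Prod>i=1..m. \<rho> i)))))"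
proof -
  obtain U u \<gamma> where "MIFS_MWSC X N \<phi> r Om \<alpha> a U u \<gamma>"
    using MIFS_MWSC_obtain[OF assms] .
  then interpret MIFS_MWSC X N \<phi> r Om \<alpha> a U u \<gamma> .
  let ?f = "\<lambda>b. ereal (ln (real (card (cut_maps N \<phi> r b))) / - ln b)"
  have dims: "lower_box_dim (K n) = Liminf (at_right 0) ?f \<and> upper_box_dim (K n) = Limsup (at_right 0) ?f \<and>
      packing_dim (K n) = Limsup (at_right 0) ?f" if "admissible_ratio \<kappa>" "1 \<le> n" for \<kappa> n
    using lower_box_dim_attractor_eq[OF that(2)] upper_box_dim_attractor_eq[OF that(2)]
      packing_dim_attractor_eq[OF that(2)] lower_box_dim_eq_cut_maps[OF that(1)]
      upper_box_dim_eq_cut_maps[OF that(1)] by simp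
  show ?thesis
  proof (intro conjI impI allI)
    assume pos: "0 < Inf {r n j | n j. 1 \<le> n \<and> 1 \<le> j \<and> j \<le> N n}"
    have "bdd_below {r n j | n j. 1 \<le> n \<and> 1 \<le> j \<and> j \<le> N n}"
    proof (rule bdd_belowI[of _ 0])
      fix x assume "x \<in> {r n j | n j. 1 \<le> n \<and> 1 \<le> j \<and> j \<le> N n}"
      then obtain n j where "x = r n j" "1 \<le> n" "j \<in> {1..N n}"
        by auto
      then show "0 \<le> x"
        using r_bounds[of n j] by simp
    qed
    then have "Inf {r n j | n j. 1 \<le> n \<and> 1 \<le> j \<and> j \<le> N n} \<le> r n j" if "1 \<le> n" "j \<in> {1..N n}" for n j
      using that by (intro cInf_lower) auto
    then have adm: "admissible_ratio (\<lambda>_. Inf {r n j | n j. 1 \<le> n \<and> 1 \<le> j \<and> j \<le> N n})"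
      using pos by (intro admissible_ratio_const)
    fix n :: nat assume n: "1 \<le> n"
    show "lower_box_dim (K n) = Liminf (at_right 0) ?f" "Limsup (at_right 0) ?f = upper_box_dim (K n)"
      "upper_box_dim (K n) = packing_dim (K n)"
      using dims[OF adm n] by simp_all
    show "Liminf (at_right 0) ?f \<le> Limsup (at_right 0) ?f"
      by (intro Liminf_le_Limsup) simp
  next
    fix \<rho> :: "nat \<Rightarrow> real" and n :: nat
    assume \<rho>: "(\<forall>n\<ge>1. \<forall>j\<in>{1..N n}. r n j = \<rho> n) \<and>
       (\<lambda>n. ln (\<rho> n) / ln (\<Prod>i=1..<n. \<rho> i)) \<longlonglongrightarrow> 0" and n: "1 \<le> n"
    then interpret MIFS_homogeneous X N \<phi> r Om \<alpha> a U u \<gamma> \<rho>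
      by unfold_locales (use \<rho> in simp_all)
    show "lower_box_dim (K n) = Liminf (at_right 0) ?f" "upper_box_dim (K n) = packing_dim (K n)"
      "packing_dim (K n) = Limsup (at_right 0) ?f"
      using dims[OF admissible_ratio_level n] by simp_all
    show "Liminf (at_right 0) ?f = liminf (\<lambda>m. ereal (ln (real (card (cut_maps N \<phi> r (\<Prod>i=1..m. \<rho> i))))
                                 / - ln (\<Prod>i=1..m. \<rho> i)))"
      using Liminf_cut_maps_eq_liminf unfolding P_def .
    show "Limsup (at_right 0) ?f = limsup (\<lambda>m. ereal (ln (real (card (cut_maps N \<phi> r (\<Prod>i=1..m. \<rho> i))))
                                 / - ln (\<Prod>i=1..m. \<rho> i)))"
      using Limsup_cut_maps_eq_limsup unfolding P_def .
  qed
qed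

end
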